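(* Let $G$ be a locally compact, second countable group with modular function $\mu_G$, and let $\lambda$ be an invariant subgroup measure of $G$, i.e. a $\sigma$-finite Borel measure on $\mathrm{Sub}_G$ that is invariant under the conjugation action of $G$. If $\lambda$ is unimodular, i.e. $\lambda$-a.e. $H\in\mathrm{Sub}_G$ is a unimodular group, then $H\leq\ker\mu_G$ for all $H$ in the topological support of $\lambda$.
   Context: Topological groups are Hausdorff. $\mathrm{Sub}_G$ is the space of closed subgroups of $G$ with the Chabauty topology, i.e. the topology with subbasis $\{H: H\cap K=\emptyset\}$ ($K\subset G$ compact) and $\{H: H\cap U\neq\emptyset\}$ ($U\subset G$ open). $G$ acts on $\mathrm{Sub}_G$ by conjugation, $H\mapsto kHk^{-1}$. The modular function $\mu_G:G\to\mathbb{R}_{>0}$ is the homomorphism defined by $\ell(S)=\mu_G(g)\,\ell(Sg)$ for every Borel $S\subset G$, where $\ell$ is a left Haar measure on $G$. The topological support of $\lambda$ is the set of $H\in\mathrm{Sub}_G$ all of whose neighborhoods have positive $\lambda$-measure. *)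

theory Defs
  imports "HOL-Analysis.Analysis" "HOL-Algebra.Coset"
begin

locale topological_group = group G for G :: "('a, 'b) monoid_scheme" (structure) +
  fixes T :: "'a topology"
  assumes topspace_eq_carrier: "topspace T = carrier G"
    and continuous_mult: "continuous_map (prod_topology T T) T (\<lambda>(x, y). x \<otimes> y)"
    and continuous_inv: "continuous_map T T (\<lambda>x. inv x)"
    and Hausdorff: "Hausdorff_space T"

definition borel_algebra :: "'a topology \<Rightarrow> 'a measure" where
  "borel_algebra T = sigma (topspace T) {U. openin T U}"

definition radon_measure :: "'a topology \<Rightarrow> 'a measure \<Rightarrow> bool" where
  "radon_measure T l \<longleftrightarrow>
     sets l = sets (borel_algebra T) \<and>
     (\<forall>K. compactin T K \<longrightarrow> emeasure l K < \<infinity>) \<and>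
     (\<forall>S \<in> sets l. emeasure l S = (INF U \<in> {U. openin T U \<and> S \<subseteq> U}. emeasure l U)) \<and>
     (\<forall>U. openin T U \<longrightarrow> emeasure l U = (SUP K \<in> {K. compactin T K \<and> K \<subseteq> U}. emeasure l K))"

text \<open>Left cosets \<open>g <# S\<close> and right cosets \<open>S #> g\<close> are used for the translates
  of arbitrary subsets \<open>S\<close> of the group.\<close>

definition left_haar_measure ::
    "('a, 'b) monoid_scheme \<Rightarrow> 'a topology \<Rightarrow> 'a measure \<Rightarrow> bool" where
  "left_haar_measure G T l \<longleftrightarrow>
     radon_measure T l \<and> emeasure l (carrier G) \<noteq> 0 \<and>
     (\<forall>g \<in> carrier G. \<forall>S \<in> sets l. emeasure l (g <#\<^bsub>G\<^esub> S) = emeasure l S)"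

definition pos_real_group :: "real monoid" where
  "pos_real_group = \<lparr>carrier = {0<..}, mult = (*), one = 1\<rparr>"

text \<open>Being the modular function is a predicate on \<open>\<mu>\<close>, which only constrains the values of
  \<open>\<mu>\<close> on the carrier. Since left Haar measures exist and are unique up to scaling on a locally
  compact group, exactly one \<open>\<mu>\<close> on the carrier satisfies it, whichever left Haar measure is
  chosen.\<close>

definition is_modular_function ::
    "('a, 'b) monoid_scheme \<Rightarrow> 'a topology \<Rightarrow> ('a \<Rightarrow> real) \<Rightarrow> bool" where
  "is_modular_function G T \<mu> \<longleftrightarrow>
     \<mu> \<in> hom G pos_real_group \<and>
     (\<exists>l. left_haar_measure G T l \<and>
        (\<forall>g \<in> carrier G. \<forall>S \<in> sets l.
           emeasure l S = ennreal (\<mu> g) * emeasure l (S #>\<^bsub>G\<^esub> g)))"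

definition unimodular :: "('a, 'b) monoid_scheme \<Rightarrow> 'a topology \<Rightarrow> bool" where
  "unimodular G T \<longleftrightarrow>
     (\<exists>\<mu>. is_modular_function G T \<mu> \<and> (\<forall>g \<in> carrier G. \<mu> g = 1))"

definition closed_subgroups :: "('a, 'b) monoid_scheme \<Rightarrow> 'a topology \<Rightarrow> 'a set set" where
  "closed_subgroups G T = {H. subgroup H G \<and> closedin T H}"

definition chabauty_topology ::
    "('a, 'b) monoid_scheme \<Rightarrow> 'a topology \<Rightarrow> 'a set topology" where
  "chabauty_topology G T = topology_generated_by
     ({{H \<in> closed_subgroups G T. H \<inter> K = {}} | K. compactin T K} \<union>
      {{H \<in> closed_subgroups G T. H \<inter> U \<noteq> {}} | U. openin T U})"

lemma topspace_chabauty_topology: "topspace (chabauty_topology G T) = closed_subgroups G T"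
proof -
  have "closed_subgroups G T \<in> {{H \<in> closed_subgroups G T. H \<inter> K = {}} | K. compactin T K}"
    by (rule CollectI, rule exI[of _ "{}"]) simp
  then show ?thesis
    unfolding chabauty_topology_def topology_generated_by_topspace by blast
qed

definition conjugate :: "('a, 'b) monoid_scheme \<Rightarrow> 'a \<Rightarrow> 'a set \<Rightarrow> 'a set" where
  "conjugate G k H = (k <#\<^bsub>G\<^esub> H) #>\<^bsub>G\<^esub> (inv\<^bsub>G\<^esub> k)"

definition invariant_subgroup_measure ::
    "('a, 'b) monoid_scheme \<Rightarrow> 'a topology \<Rightarrow> 'a set measure \<Rightarrow> bool" where
  "invariant_subgroup_measure G T \<nu> \<longleftrightarrow>
     sets \<nu> = sets (borel_algebra (chabauty_topology G T)) \<and>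
     sigma_finite_measure \<nu> \<and>
     (\<forall>k \<in> carrier G. \<forall>A \<in> sets \<nu>. emeasure \<nu> (conjugate G k ` A) = emeasure \<nu> A)"

definition unimodular_subgroup_measure ::
    "('a, 'b) monoid_scheme \<Rightarrow> 'a topology \<Rightarrow> 'a set measure \<Rightarrow> bool" where
  "unimodular_subgroup_measure G T \<nu> \<longleftrightarrow>
     (AE H in \<nu>. unimodular (G\<lparr>carrier := H\<rparr>) (subtopology T H))"

text \<open>Quantifying over open neighbourhoods suffices, as every neighbourhood contains one.\<close>

definition topological_support :: "'a topology \<Rightarrow> 'a measure \<Rightarrow> 'a set" where
  "topological_support T \<nu> =
     {x \<in> topspace T. \<forall>U. openin T U \<and> x \<in> U \<longrightarrow> emeasure \<nu> U > 0}"

end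

theory Submission
  imports Defs
begin

text \<open>The idea is to compute one integral in two ways. Suppose that a subgroup in the support
  does not lie in the kernel of \<open>\<mu>\<close>. Passing to an inverse if necessary, it contains an element
  on which \<open>\<mu>\<close> exceeds 1. Since \<open>\<mu>\<close> is lower semicontinuous, that element
  has a compact neighbourhood \<open>C\<close> on which \<open>\<mu>\<close> exceeds some \<open>c > 1\<close>, and the subgroups that
  meet \<open>C\<close> have positive measure; let \<open>A\<close> be a set of such subgroups of finite positive measure.
  Choose measurably an element \<open>k H\<close> of each closed subgroup \<open>H\<close>, with \<open>k H\<close> in \<open>C\<close> for
  \<open>H\<close> in \<open>A\<close>.

  On pairs \<open>(H, g)\<close> of a closed subgroup and a group element consider the map
  \<open>(H, g) \<mapsto> (H, g k(g\<^sup>-\<^sup>1 H g))\<close>, and the product \<open>\<nu> \<Otimes> l\<close> with a left Haar measure \<open>l\<close>.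

  First, fix \<open>H\<close>. Since \<open>k(g\<^sup>-\<^sup>1 H g)\<close> depends only on the coset \<open>H g\<close> and lies in \<open>g\<^sup>-\<^sup>1 H g\<close>,
  the map sends every coset \<open>H g\<close> to itself, acting on it as a right translation. If \<open>H\<close> is
  unimodular, its Haar measure, copied to the coset, is invariant under this, and hence so is
  \<open>l\<close> (\<open>nn_integral_orbit_map\<close>).

  Second, fix \<open>H' = g\<^sup>-\<^sup>1 H g\<close> instead. As \<open>\<nu>\<close> is invariant under conjugation, the product measure
  is the same in the coordinates \<open>(H', g)\<close>; there the map is \<open>g \<mapsto> g k(H')\<close>, which scales
  \<open>l\<close> by the value of the modular function at \<open>k(H')\<close>.

  Comparing the two, the integral over \<open>A\<close> of \<open>\<mu> (k H)\<close> is the measure of \<open>A\<close>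
  (\<open>nn_integral_modular_selection\<close>), which contradicts \<open>\<mu> (k H) \<ge> c > 1\<close> on \<open>A\<close>.

  The measure theory rests on second countability: compact sets can be replaced by countably
  many (\<open>countable_compact_separation\<close>), so the Chabauty Borel algebra is generated by the
  conditions of avoiding a compact set, conjugation is jointly measurable, and \<open>k\<close> exists
  (\<open>measurable_selection_compact\<close>).\<close>

section \<open>Borel algebras of topological spaces\<close>

lemma space_borel_algebra [simp]: "space (borel_algebra T) = topspace T"
  by (simp add: borel_algebra_def space_measure_of_conv)

lemma sets_borel_algebra: "sets (borel_algebra T) = sigma_sets (topspace T) {U. openin T U}"
  unfolding borel_algebra_def by (rule sets_measure_of) (auto dest: openin_subset)

lemma openin_imp_sets_borel_algebra: "openin T U \<Longrightarrow> U \<in> sets (borel_algebra T)"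
  by (simp add: sets_borel_algebra sigma_sets.Basic)

lemma closedin_imp_sets_borel_algebra:
  assumes "closedin T F"
  shows "F \<in> sets (borel_algebra T)"
proof -
  have "topspace T - (topspace T - F) \<in> sets (borel_algebra T)"
    using assms openin_imp_sets_borel_algebra[of T "topspace T - F"]
    by (metis closedin_def sets.compl_sets space_borel_algebra)
  then show ?thesis
    using closedin_subset[OF assms] by (simp add: double_diff)
qed

lemma measurable_borel_algebraI:
  assumes "f \<in> space M \<rightarrow> topspace T"
    and "\<And>U. openin T U \<Longrightarrow> f -` U \<inter> space M \<in> sets M"
  shows "f \<in> measurable M (borel_algebra T)"
  by (rule measurable_sigma_sets[OF sets_borel_algebra _ assms(1)])
     (use assms(2) in \<open>auto dest: openin_subset\<close>)

lemma measurable_borel_algebra_closedI: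
  assumes f: "f \<in> space M \<rightarrow> topspace T"
    and cl: "\<And>F. closedin T F \<Longrightarrow> f -` F \<inter> space M \<in> sets M"
  shows "f \<in> measurable M (borel_algebra T)"
proof (rule measurable_borel_algebraI[OF f])
  fix U assume "openin T U"
  then have "closedin T (topspace T - U)" and "U \<subseteq> topspace T"
    by (auto dest: openin_subset)
  then have "space M - (f -` (topspace T - U) \<inter> space M) \<in> sets M"
    using cl by blast
  moreover have "f -` U \<inter> space M = space M - (f -` (topspace T - U) \<inter> space M)"
    using f by auto
  ultimately show "f -` U \<inter> space M \<in> sets M"
    by simp
qed

lemma continuous_map_measurable:
  assumes "continuous_map T T' f"
  shows "f \<in> measurable (borel_algebra T) (borel_algebra T')"
proof (rule measurable_borel_algebraI)
  show "f \<in> space (borel_algebra T) \<rightarrow> topspace T'"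
    using continuous_map_funspace[OF assms] by simp
  fix U assume "openin T' U"
  then have "openin T {x \<in> topspace T. f x \<in> U}"
    using assms by (simp add: continuous_map_def)
  moreover have "{x \<in> topspace T. f x \<in> U} = f -` U \<inter> space (borel_algebra T)"
    by auto
  ultimately show "f -` U \<inter> space (borel_algebra T) \<in> sets (borel_algebra T)"
    by (metis openin_imp_sets_borel_algebra)
qed

text \<open>Second countability enters here: an open subset of the product is a countable union of
  open rectangles, so it belongs to the product of the Borel algebras.\<close>

lemma continuous_map_prod_measurable:
  assumes sc: "second_countable T1" "second_countable T2"
    and f: "continuous_map (prod_topology T1 T2) T3 f"
  shows "f \<in> measurable (borel_algebra T1 \<Otimes>\<^sub>M borel_algebra T2) (borel_algebra T3)"
proof (rule measurable_borel_algebraI)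
  show "f \<in> space (borel_algebra T1 \<Otimes>\<^sub>M borel_algebra T2) \<rightarrow> topspace T3"
    using continuous_map_funspace[OF f] by (simp add: space_pair_measure)
  fix U assume "openin T3 U"
  define W where "W = f -` U \<inter> space (borel_algebra T1 \<Otimes>\<^sub>M borel_algebra T2)"
  have "W = {x \<in> topspace (prod_topology T1 T2). f x \<in> U}"
    by (auto simp: W_def space_pair_measure)
  then have W: "openin (prod_topology T1 T2) W"
    using f \<open>openin T3 U\<close> by (simp only: continuous_map_def)
  obtain A where A: "countable A" "\<And>V. V \<in> A \<Longrightarrow> openin T1 V"
    "\<And>U x. openin T1 U \<Longrightarrow> x \<in> U \<Longrightarrow> \<exists>V\<in>A. x \<in> V \<and> V \<subseteq> U"
    using sc(1) by (auto simp: second_countable_def)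
  obtain B where B: "countable B" "\<And>V. V \<in> B \<Longrightarrow> openin T2 V"
    "\<And>U x. openin T2 U \<Longrightarrow> x \<in> U \<Longrightarrow> \<exists>V\<in>B. x \<in> V \<and> V \<subseteq> U"
    using sc(2) by (auto simp: second_countable_def)
  have "W = (\<Union>(V, V') \<in> {p \<in> A \<times> B. fst p \<times> snd p \<subseteq> W}. V \<times> V')" (is "_ = ?R")
  proof
    show "W \<subseteq> ?R"
    proof
      fix z assume "z \<in> W"
      then obtain x y where z: "z = (x, y)" "(x, y) \<in> W"
        by (cases z) auto
      then obtain O1 O2 where O: "openin T1 O1" "openin T2 O2" "x \<in> O1" "y \<in> O2" "O1 \<times> O2 \<subseteq> W"
        using W[unfolded openin_prod_topology_alt, rule_format, OF z(2)] by blast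
      obtain V where V: "V \<in> A" "x \<in> V" "V \<subseteq> O1"
        using A(3) O by blast
      obtain V' where V': "V' \<in> B" "y \<in> V'" "V' \<subseteq> O2"
        using B(3) O by blast
      have "V \<times> V' \<subseteq> W"
        using V V' O by blast
      with V V' show "z \<in> ?R"
        unfolding z by (intro UN_I[of "(V, V')"]) auto
    qed
  qed auto
  moreover have "?R \<in> sets (borel_algebra T1 \<Otimes>\<^sub>M borel_algebra T2)"
  proof (rule sets.countable_UN'')
    show "countable {p \<in> A \<times> B. fst p \<times> snd p \<subseteq> W}"
      using A(1) B(1) by (auto intro: countable_subset[of _ "A \<times> B"])
    fix p assume p: "p \<in> {p \<in> A \<times> B. fst p \<times> snd p \<subseteq> W}"
    have "fst p \<times> snd p \<in> sets (borel_algebra T1 \<Otimes>\<^sub>M borel_algebra T2)"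
      by (intro pair_measureI openin_imp_sets_borel_algebra A(2) B(2)) (use p in auto)
    then show "(case p of (V, V') \<Rightarrow> V \<times> V') \<in> sets (borel_algebra T1 \<Otimes>\<^sub>M borel_algebra T2)"
      by (simp add: case_prod_beta)
  qed
  ultimately have "W \<in> sets (borel_algebra T1 \<Otimes>\<^sub>M borel_algebra T2)"
    by (rule ssubst)
  then show "f -` U \<inter> space (borel_algebra T1 \<Otimes>\<^sub>M borel_algebra T2)
      \<in> sets (borel_algebra T1 \<Otimes>\<^sub>M borel_algebra T2)"
    by (simp only: W_def)
qed

section \<open>Countably many compact neighbourhoods\<close>

lemma openin_uniformly_on_compact:
  assumes f: "continuous_map (prod_topology T1 T2) T3 f" and K: "compactin T2 K"
    and V: "openin T3 V"
  shows "openin T1 {g \<in> topspace T1. \<forall>x\<in>K. f (g, x) \<in> V}"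
proof (subst openin_subopen, safe)
  fix g assume g: "g \<in> topspace T1" "\<forall>x\<in>K. f (g, x) \<in> V"
  define W where "W = {p \<in> topspace (prod_topology T1 T2). f p \<in> V}"
  have W: "openin (prod_topology T1 T2) W"
    using f V by (simp only: continuous_map_def W_def)
  have "{g} \<times> K \<subseteq> W"
    using g compactin_subset_topspace[OF K] by (auto simp: W_def)
  then obtain U U' where U: "openin T1 U" "g \<in> U" "K \<subseteq> U'" "U \<times> U' \<subseteq> W"
    using tube_lemma_right[OF W K g(1)] by blast
  have "U \<subseteq> {g \<in> topspace T1. \<forall>x\<in>K. f (g, x) \<in> V}"
    using U openin_subset[OF U(1)] by (auto simp: W_def)
  with U show "\<exists>U. openin T1 U \<and> g \<in> U \<and> U \<subseteq> {g \<in> topspace T1. \<forall>x\<in>K. f (g, x) \<in> V}"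
    by blast
qed

text \<open>In a locally compact second countable Hausdorff space, a compact set and a disjoint closed
  set are separated by one of countably many pairs \<open>V \<subseteq> L\<close> of an open and a compact set: finite
  unions of basic open sets with compact closure. This single fact makes compact sets, which
  form an uncountable family, accessible to \<open>\<sigma>\<close>-algebras.\<close>

lemma countable_compact_separation:
  assumes lc: "locally_compact_space T" and hd: "Hausdorff_space T" and sc: "second_countable T"
  obtains \<L> where "countable \<L>"
    and "\<And>V L. (V, L) \<in> \<L> \<Longrightarrow> openin T V \<and> compactin T L \<and> V \<subseteq> L"
    and "\<And>K F. compactin T K \<Longrightarrow> closedin T F \<Longrightarrow> K \<inter> F = {} \<Longrightarrow>
           \<exists>V L. (V, L) \<in> \<L> \<and> K \<subseteq> V \<and> L \<inter> F = {}"
proof -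
  let ?cl = "Abstract_Topology.closure_of T"
  obtain B where B: "countable B" "\<And>V. V \<in> B \<Longrightarrow> openin T V"
    "\<And>U x. openin T U \<Longrightarrow> x \<in> U \<Longrightarrow> \<exists>V\<in>B. x \<in> V \<and> V \<subseteq> U"
    using sc by (auto simp: second_countable_def)
  define \<L> where "\<L> = (\<lambda>\<V>. (\<Union>\<V>, ?cl (\<Union>\<V>))) `
    {\<V> \<in> Fpow B. compactin T (?cl (\<Union>\<V>))}"
  have "countable \<L>"
    unfolding \<L>_def
    by (intro countable_image countable_subset[OF _ countable_Fpow[OF B(1)]]) blast
  moreover have "openin T V \<and> compactin T L \<and> V \<subseteq> L" if "(V, L) \<in> \<L>" for V L
  proof -
    from that obtain \<V> where "(V, L) = (\<Union>\<V>, ?cl (\<Union>\<V>))" "\<V> \<in> Fpow B"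
      "compactin T (?cl (\<Union>\<V>))"
      unfolding \<L>_def by (elim imageE CollectE conjE)
    then have \<V>: "\<V> \<subseteq> B" "V = \<Union>\<V>" "L = ?cl (\<Union>\<V>)" "compactin T L"
      by (auto simp: Fpow_def)
    have "openin T V"
      unfolding \<V>(2) using \<V>(1) B(2) by (intro openin_Union) blast
    then have "V \<subseteq> L"
      unfolding \<V>(3) \<V>(2)[symmetric] by (intro closure_of_subset openin_subset)
    with \<V> \<open>openin T V\<close> show ?thesis
      by simp
  qed
  moreover have "\<exists>V L. (V, L) \<in> \<L> \<and> K \<subseteq> V \<and> L \<inter> F = {}"
    if K: "compactin T K" and F: "closedin T F" and disj: "K \<inter> F = {}" for K F
  proof -
    have base: "neighbourhood_base_of (\<lambda>C. compactin T C \<and> closedin T C) T"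
      using locally_compact_regular_space_neighbourhood_base[of T]
        locally_compact_Hausdorff_imp_regular_space[OF lc hd] lc by simp
    have *: "\<exists>V\<in>B. x \<in> V \<and> compactin T (?cl V) \<and> ?cl V \<inter> F = {}" if "x \<in> K" for x
    proof -
      have "openin T (topspace T - F)" "x \<in> topspace T - F"
        using F disj that compactin_subset_topspace[OF K] by auto
      then obtain U C where UC: "openin T U" "compactin T C" "closedin T C" "x \<in> U" "U \<subseteq> C"
        "C \<subseteq> topspace T - F"
        using base[unfolded neighbourhood_base_of, rule_format, OF conjI] by metis
      obtain V where V: "V \<in> B" "x \<in> V" "V \<subseteq> U"
        using B(3)[OF UC(1,4)] by (elim bexE conjE)
      have "?cl V \<subseteq> C"
        using V UC(3,5) by (intro closure_of_minimal order_trans[of V U C])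
      moreover from this have "compactin T (?cl V)"
        using closed_compactin[OF UC(2)] by simp
      ultimately show ?thesis
        using V(1,2) UC(6) by blast
    qed
    define \<U> where "\<U> = {V \<in> B. compactin T (?cl V) \<and> ?cl V \<inter> F = {}}"
    have cover: "K \<subseteq> \<Union>\<U>"
    proof
      fix x assume "x \<in> K"
      then show "x \<in> \<Union>\<U>"
        using *[of x] unfolding \<U>_def by blast
    qed
    have "openin T V" if "V \<in> \<U>" for V
      using that B(2) by (simp add: \<U>_def)
    from compactinD[OF K this cover]
    obtain \<V> where \<V>: "finite \<V>" "\<V> \<subseteq> \<U>" "K \<subseteq> \<Union>\<V>"
      by metis
    have cl: "?cl (\<Union>\<V>) = (\<Union>V\<in>\<V>. ?cl V)"
      using \<V>(1) by (simp add: closure_of_Union)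
    have "compactin T (?cl (\<Union>\<V>))"
      unfolding cl using \<V> by (intro compactin_Union) (auto simp: \<U>_def)
    moreover have "\<V> \<in> Fpow B"
      using \<V> by (auto simp: \<U>_def Fpow_def)
    ultimately have "(\<Union>\<V>, ?cl (\<Union>\<V>)) \<in> \<L>"
      unfolding \<L>_def by (intro imageI CollectI conjI)
    moreover have "?cl (\<Union>\<V>) \<inter> F = {}"
      unfolding cl using \<V>(2) by (auto simp: \<U>_def)
    ultimately show ?thesis
      using \<V>(3) by blast
  qed
  ultimately show ?thesis
    by (rule that)
qed

section \<open>Measurable selection from compact sets\<close>

text \<open>A point of each compact set \<open>\<Phi> x\<close> is found by successive refinement. Fix countably many closed
  sets \<open>B i\<close> that separate points; whenever the current set meets \<open>B i\<close>, cut it down to the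
  part inside \<open>B i\<close>. By compactness the decreasing sets \<open>D x i\<close> have a common point, and only
  one, for a separating \<open>B i\<close> would have cut away one of two points. That point lies in a
  closed set \<open>F\<close> exactly when every \<open>D x i\<close> meets \<open>F\<close>, which is a measurable condition
  by induction on \<open>i\<close>.\<close>

lemma measurable_selection_compact:
  assumes hd: "Hausdorff_space T" and sc: "second_countable T"
    and compact: "\<And>x. x \<in> space M \<Longrightarrow> compactin T (\<Phi> x) \<and> \<Phi> x \<noteq> {}"
    and meas: "\<And>F. closedin T F \<Longrightarrow> {x \<in> space M. \<Phi> x \<inter> F \<noteq> {}} \<in> sets M"
  obtains s where "s \<in> measurable M (borel_algebra T)" and "\<And>x. x \<in> space M \<Longrightarrow> s x \<in> \<Phi> x"
proof -
  let ?cl = "Abstract_Topology.closure_of T"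
  obtain \<B> where \<B>: "countable \<B>" "\<And>V. V \<in> \<B> \<Longrightarrow> openin T V"
    "\<And>U x. openin T U \<Longrightarrow> x \<in> U \<Longrightarrow> \<exists>V\<in>\<B>. x \<in> V \<and> V \<subseteq> U"
    using sc by (auto simp: second_countable_def)
  \<comment> \<open>The empty set is added only because an enumeration needs a nonempty set.\<close>
  define B where "B i = ?cl (from_nat_into (insert {} \<B>) i)" for i
  have closed_B: "closedin T (B i)" for i
    by (simp add: B_def)
  have separate: "\<exists>i. x \<in> B i \<and> y \<notin> B i" if "x \<in> topspace T" "y \<in> topspace T" "x \<noteq> y" for x y
  proof -
    have "\<exists>U V. openin T U \<and> openin T V \<and> x \<in> U \<and> y \<in> V \<and> disjnt U V"
      using hd that unfolding Hausdorff_space_def by simp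
    then obtain U V where UV: "openin T U" "openin T V" "x \<in> U" "y \<in> V" "disjnt U V"
      by metis
    obtain O' where O': "O' \<in> \<B>" "x \<in> O'" "O' \<subseteq> U"
      using \<B>(3)[OF UV(1,3)] by (elim bexE conjE)
    obtain i where i: "from_nat_into (insert {} \<B>) i = O'"
      using from_nat_into_surj[of "insert {} \<B>" O'] O' \<B>(1) by auto
    have "x \<in> B i"
      using O'(2) closure_of_subset[OF openin_subset[OF \<B>(2)[OF O'(1)]]] unfolding B_def i by blast
    moreover have "?cl O' \<inter> V = {}"
    proof -
      have "V \<inter> O' = {}"
        using UV O' by (auto simp: disjnt_def)
      then show ?thesis
        using openin_Int_closure_of_eq_empty[OF UV(2), of O'] by blast
    qed
    ultimately show ?thesis
      using UV(4) i unfolding B_def by blast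
  qed
  define D where "D x = rec_nat (\<Phi> x) (\<lambda>i S. if S \<inter> B i \<noteq> {} then S \<inter> B i else S)" for x
  have D_0: "D x 0 = \<Phi> x"
    and D_Suc: "D x (Suc i) = (if D x i \<inter> B i \<noteq> {} then D x i \<inter> B i else D x i)" for x i
    by (simp_all add: D_def)
  have D: "compactin T (D x i) \<and> D x i \<noteq> {} \<and> D x i \<subseteq> \<Phi> x" if "x \<in> space M" for x i
    using compact[OF that] closed_B
    by (induction i) (auto simp: D_0 D_Suc intro: compact_Int_closedin)
  have D_sub: "D x i \<subseteq> topspace T" if "x \<in> space M" for x i
    using D[OF that, of i] by (simp add: compactin_subset_topspace)
  have D_meas: "{x \<in> space M. D x i \<inter> F \<noteq> {}} \<in> sets M" if "closedin T F" for i F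
    using that
  proof (induction i arbitrary: F)
    case 0
    then show ?case
      using meas by (simp add: D_0)
  next
    case (Suc i)
    have "{x \<in> space M. D x (Suc i) \<inter> F \<noteq> {}} =
        {x \<in> space M. D x i \<inter> B i \<noteq> {}} \<inter> {x \<in> space M. D x i \<inter> (B i \<inter> F) \<noteq> {}} \<union>
        ({x \<in> space M. D x i \<inter> F \<noteq> {}} - {x \<in> space M. D x i \<inter> B i \<noteq> {}})"
      by (auto simp: D_Suc split: if_splits)
    moreover have "\<dots> \<in> sets M"
      by (intro sets.Int sets.Un sets.Diff Suc.IH Suc.prems closed_B closedin_Int)
    ultimately show ?case
      by simp
  qed
  have decr: "D x j \<subseteq> D x i" if "i \<le> j" for x i j
    by (rule lift_Suc_antimono_le[OF _ that]) (auto simp: D_Suc)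
  have meet: "(\<Inter>i. D x i) \<inter> F \<noteq> {}"
    if x: "x \<in> space M" and F: "closedin T F" and ne: "\<And>i. D x i \<inter> F \<noteq> {}" for x F
  proof -
    have "compactin T (D x 0)"
      using D[OF x, of 0] by simp
    then have fip: "\<forall>\<U>. (\<forall>C\<in>\<U>. closedin T C) \<and>
        (\<forall>\<F>. finite \<F> \<and> \<F> \<subseteq> \<U> \<longrightarrow> D x 0 \<inter> \<Inter>\<F> \<noteq> {}) \<longrightarrow> D x 0 \<inter> \<Inter>\<U> \<noteq> {}"
      unfolding compactin_fip by (rule conjunct2)
    have "D x 0 \<inter> \<Inter>(range (\<lambda>i. D x i \<inter> F)) \<noteq> {}"
    proof (rule fip[THEN spec, THEN mp], intro conjI allI impI ballI)
      fix C assume "C \<in> range (\<lambda>i. D x i \<inter> F)"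
      moreover have "closedin T (D x i \<inter> F)" for i
        using D[OF x, of i] by (intro closedin_Int F compactin_imp_closedin[OF hd]) simp
      ultimately show "closedin T C"
        by auto
    next
      fix \<F> assume "finite \<F> \<and> \<F> \<subseteq> range (\<lambda>i. D x i \<inter> F)"
      then obtain J where J: "finite J" "\<F> = (\<lambda>i. D x i \<inter> F) ` J"
        using finite_subset_image[of \<F> "\<lambda>i. D x i \<inter> F" UNIV] by auto
      obtain n where n: "\<And>j. j \<in> J \<Longrightarrow> j \<le> n"
        using J(1) unfolding finite_nat_set_iff_bounded_le by metis
      have "D x n \<inter> F \<subseteq> D x j \<inter> F" if "j \<in> J" for j
        using decr[OF n[OF that]] by blast
      moreover have "D x n \<subseteq> D x 0"
        by (rule decr) simp
      ultimately have "D x n \<inter> F \<subseteq> D x 0 \<inter> \<Inter>\<F>"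
        unfolding J(2) by blast
      then show "D x 0 \<inter> \<Inter>\<F> \<noteq> {}"
        using ne[of n] by blast
    qed
    then show ?thesis
      by auto
  qed
  have unique: "y = z" if x: "x \<in> space M" and yz: "y \<in> (\<Inter>i. D x i)" "z \<in> (\<Inter>i. D x i)" for x y z
  proof (rule ccontr)
    assume "y \<noteq> z"
    have "y \<in> topspace T" "z \<in> topspace T"
      using yz D_sub[OF x, of 0] by auto
    then obtain i where i: "y \<in> B i" "z \<notin> B i"
      using separate[OF _ _ \<open>y \<noteq> z\<close>] by metis
    have "y \<in> D x i"
      using yz(1) by simp
    then have "D x (Suc i) \<subseteq> B i"
      using i(1) unfolding D_Suc by auto
    moreover have "z \<in> D x (Suc i)"
      using yz(2) by blast
    ultimately show False
      using i(2) by blast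
  qed
  define s where "s x = (SOME y. y \<in> (\<Inter>i. D x i))" for x
  have s: "s x \<in> (\<Inter>i. D x i)" if "x \<in> space M" for x
  proof -
    have "D x i \<inter> topspace T \<noteq> {}" for i
      using D[OF that, of i] D_sub[OF that, of i] by auto
    then have "(\<Inter>i. D x i) \<noteq> {}"
      using meet[OF that closedin_topspace] by auto
    then show ?thesis
      unfolding s_def some_in_eq .
  qed
  have "s \<in> measurable M (borel_algebra T)"
  proof (rule measurable_borel_algebra_closedI)
    show "s \<in> space M \<rightarrow> topspace T"
    proof
      fix x assume "x \<in> space M"
      from s[OF this] D_sub[OF this, of 0] show "s x \<in> topspace T"
        by auto
    qed
    fix F assume F: "closedin T F"
    have "s -` F \<inter> space M = (\<Inter>i. {x \<in> space M. D x i \<inter> F \<noteq> {}})"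
    proof (intro equalityI subsetI)
      fix x assume "x \<in> (\<Inter>i. {x \<in> space M. D x i \<inter> F \<noteq> {}})"
      then have x: "x \<in> space M" and "\<And>i. D x i \<inter> F \<noteq> {}"
        by auto
      then obtain y where "y \<in> (\<Inter>i. D x i)" "y \<in> F"
        using meet[OF x F] by auto
      with unique[OF x _ s[OF x]] x show "x \<in> s -` F \<inter> space M"
        by auto
    next
      fix x assume x: "x \<in> s -` F \<inter> space M"
      then have "s x \<in> D x i \<inter> F" for i
        using s[of x] by auto
      with x show "x \<in> (\<Inter>i. {x \<in> space M. D x i \<inter> F \<noteq> {}})"
        by blast
    qed
    also have "\<dots> \<in> sets M"
      using D_meas[OF F] by (intro sets.countable_INT) auto
    finally show "s -` F \<inter> space M \<in> sets M" .
  qed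
  moreover have "s x \<in> \<Phi> x" if "x \<in> space M" for x
    using s[OF that] D_0[of x] by auto
  ultimately show ?thesis
    by (rule that)
qed

section \<open>Haar measures and translations\<close>

context topological_group
begin

lemma continuous_map_group_mult:
  assumes "continuous_map X T f" "continuous_map X T g"
  shows "continuous_map X T (\<lambda>x. f x \<otimes> g x)"
  using continuous_map_compose[OF continuous_map_pairedI[OF assms] continuous_mult]
  by (simp add: o_def)

lemma continuous_map_group_inv:
  assumes "continuous_map X T f"
  shows "continuous_map X T (\<lambda>x. inv (f x))"
  using continuous_map_compose[OF assms continuous_inv] by (simp add: o_def)

lemma continuous_map_group_const: "g \<in> carrier G \<Longrightarrow> continuous_map X T (\<lambda>_. g)"
  by (simp add: topspace_eq_carrier)

lemma l_coset_eq_vimage: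
  assumes "g \<in> carrier G" "S \<subseteq> carrier G"
  shows "g <# S = {x \<in> carrier G. inv g \<otimes> x \<in> S}"
proof (intro equalityI subsetI)
  fix x assume "x \<in> g <# S"
  then obtain s where "s \<in> S" "x = g \<otimes> s"
    by (auto simp: l_coset_def)
  then show "x \<in> {x \<in> carrier G. inv g \<otimes> x \<in> S}"
    using assms by (auto simp: m_assoc[symmetric])
next
  fix x assume "x \<in> {x \<in> carrier G. inv g \<otimes> x \<in> S}"
  then have "inv g \<otimes> x \<in> S" "x = g \<otimes> (inv g \<otimes> x)"
    using assms by (auto simp: m_assoc[symmetric])
  then show "x \<in> g <# S"
    unfolding l_coset_def by blast
qed

lemma r_coset_eq_vimage:
  assumes "g \<in> carrier G" "S \<subseteq> carrier G"
  shows "S #> g = {x \<in> carrier G. x \<otimes> inv g \<in> S}"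
proof (intro equalityI subsetI)
  fix x assume "x \<in> S #> g"
  then obtain s where "s \<in> S" "x = s \<otimes> g"
    by (auto simp: r_coset_def)
  then show "x \<in> {x \<in> carrier G. x \<otimes> inv g \<in> S}"
    using assms by (auto simp: m_assoc)
next
  fix x assume "x \<in> {x \<in> carrier G. x \<otimes> inv g \<in> S}"
  then have "x \<otimes> inv g \<in> S" "x = (x \<otimes> inv g) \<otimes> g"
    using assms by (auto simp: m_assoc)
  then show "x \<in> S #> g"
    unfolding r_coset_def by blast
qed

lemma compactin_r_coset:
  assumes "compactin T K" "g \<in> carrier G"
  shows "compactin T (K #> g)"
proof -
  have "K #> g = (\<lambda>x. x \<otimes> g) ` K"
    by (auto simp: r_coset_def)
  then show ?thesis
    using image_compactin[OF assms(1) continuous_map_group_mult[OF continuous_map_id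
          continuous_map_group_const[OF assms(2)]]]
    by simp
qed

lemma topological_group_subgroup:
  assumes "subgroup H G"
  shows "topological_group (G\<lparr>carrier := H\<rparr>) (subtopology T H)"
proof -
  interpret H: group "G\<lparr>carrier := H\<rparr>"
    using assms by (rule subgroup_imp_group)
  have H: "H \<subseteq> carrier G"
    using assms by (rule subgroup.subset)
  have fst: "continuous_map (prod_topology (subtopology T H) (subtopology T H)) T fst"
    using continuous_map_fst continuous_map_into_fulltopology by blast
  have snd: "continuous_map (prod_topology (subtopology T H) (subtopology T H)) T snd"
    using continuous_map_snd continuous_map_into_fulltopology by blast
  show ?thesis
  proof unfold_locales
    show "topspace (subtopology T H) = carrier (G\<lparr>carrier := H\<rparr>)"
      using H by (auto simp: topspace_eq_carrier)
    show "continuous_map (prod_topology (subtopology T H) (subtopology T H)) (subtopology T H)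
        (\<lambda>(x, y). x \<otimes>\<^bsub>G\<lparr>carrier := H\<rparr>\<^esub> y)"
      unfolding continuous_map_in_subtopology split_def
      using continuous_map_group_mult[OF fst snd] subgroup.m_closed[OF assms] by auto
    have "continuous_map (subtopology T H) T (\<lambda>x. inv x)"
      by (intro continuous_map_from_subtopology continuous_inv)
    then have "continuous_map (subtopology T H) (subtopology T H) (\<lambda>x. inv x)"
      using subgroup.m_inv_closed[OF assms] by (auto simp: continuous_map_in_subtopology)
    then show "continuous_map (subtopology T H) (subtopology T H) (\<lambda>x. inv\<^bsub>G\<lparr>carrier := H\<rparr>\<^esub> x)"
      by (rule continuous_map_eq) (simp add: m_inv_consistent[OF assms])
    show "Hausdorff_space (subtopology T H)"
      by (intro Hausdorff_space_subtopology Hausdorff)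
  qed
qed

lemma left_haar_measure_sets:
  assumes "left_haar_measure G T l"
  shows "sets l = sets (borel_algebra T)" and "space l = carrier G"
proof -
  show *: "sets l = sets (borel_algebra T)"
    using assms by (simp add: left_haar_measure_def radon_measure_def)
  show "space l = carrier G"
    using sets_eq_imp_space_eq[OF *] by (simp add: topspace_eq_carrier)
qed

lemma continuous_map_measurable_haar:
  assumes "left_haar_measure G T l" "continuous_map T T f"
  shows "f \<in> measurable l l"
  using continuous_map_measurable[OF assms(2)] left_haar_measure_sets(1)[OF assms(1)]
  by (simp cong: measurable_cong_sets)

lemma haar_compact_finite:
  assumes "left_haar_measure G T l" "compactin T K"
  shows "emeasure l K < \<infinity>"
  using assms by (simp add: left_haar_measure_def radon_measure_def)

lemma haar_compact_sets:
  assumes "left_haar_measure G T l" "compactin T K"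
  shows "K \<in> sets l"
  using closedin_imp_sets_borel_algebra compactin_imp_closedin[OF Hausdorff assms(2)]
  by (simp add: left_haar_measure_sets(1)[OF assms(1)])

lemma haar_compact_positive:
  assumes "left_haar_measure G T l"
  obtains K where "compactin T K" "emeasure l K \<noteq> 0"
proof -
  have "openin T (carrier G)"
    by (metis openin_topspace topspace_eq_carrier)
  then have "(SUP K \<in> {K. compactin T K \<and> K \<subseteq> carrier G}. emeasure l K) = emeasure l (carrier G)"
    using assms by (simp add: left_haar_measure_def radon_measure_def)
  moreover have "emeasure l (carrier G) \<noteq> 0"
    using assms by (simp add: left_haar_measure_def)
  ultimately have "\<exists>K\<in>{K. compactin T K \<and> K \<subseteq> carrier G}. emeasure l K \<noteq> 0"
    by (metis (no_types, lifting) SUP_bot_conv(1) bot_ennreal)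
  then show ?thesis
    using that by blast
qed

lemma nn_integral_haar_left_translate:
  assumes l: "left_haar_measure G T l" and g: "g \<in> carrier G" and f: "f \<in> borel_measurable l"
  shows "(\<integral>\<^sup>+x. f (g \<otimes> x) \<partial>l) = (\<integral>\<^sup>+x. f x \<partial>l)"
proof -
  have t: "(\<lambda>x. g \<otimes> x) \<in> measurable l l"
    by (intro continuous_map_measurable_haar[OF l] continuous_map_group_mult
        continuous_map_group_const[OF g] continuous_map_id[unfolded id_def])
  have "distr l l (\<lambda>x. g \<otimes> x) = l"
  proof (rule measure_eqI)
    fix A assume "A \<in> sets (distr l l (\<lambda>x. g \<otimes> x))"
    then have A: "A \<in> sets l" "A \<subseteq> carrier G"
      using sets.sets_into_space left_haar_measure_sets(2)[OF l] by auto
    have "(\<lambda>x. g \<otimes> x) -` A \<inter> space l = inv g <# A"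
      using g A(2) by (auto simp: l_coset_eq_vimage left_haar_measure_sets(2)[OF l])
    then show "emeasure (distr l l (\<lambda>x. g \<otimes> x)) A = emeasure l A"
      using A l g by (simp add: emeasure_distr[OF t] left_haar_measure_def)
  qed simp
  then show ?thesis
    using nn_integral_distr[OF t, of f] f by simp
qed

lemma nn_integral_haar_right_translate:
  assumes l: "left_haar_measure G T l" and g: "g \<in> carrier G" and f: "f \<in> borel_measurable l"
    and inv: "\<And>g S. g \<in> carrier G \<Longrightarrow> S \<in> sets l \<Longrightarrow> emeasure l S = emeasure l (S #> g)"
  shows "(\<integral>\<^sup>+x. f (x \<otimes> g) \<partial>l) = (\<integral>\<^sup>+x. f x \<partial>l)"
proof -
  have t: "(\<lambda>x. x \<otimes> g) \<in> measurable l l"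
    by (intro continuous_map_measurable_haar[OF l] continuous_map_group_mult
        continuous_map_group_const[OF g] continuous_map_id[unfolded id_def])
  have "distr l l (\<lambda>x. x \<otimes> g) = l"
  proof (rule measure_eqI)
    fix A assume "A \<in> sets (distr l l (\<lambda>x. x \<otimes> g))"
    then have A: "A \<in> sets l" "A \<subseteq> carrier G"
      using sets.sets_into_space left_haar_measure_sets(2)[OF l] by auto
    have "(\<lambda>x. x \<otimes> g) -` A \<inter> space l = A #> inv g"
      using g A(2) by (auto simp: r_coset_eq_vimage left_haar_measure_sets(2)[OF l])
    then show "emeasure (distr l l (\<lambda>x. x \<otimes> g)) A = emeasure l A"
      using inv[OF inv_closed[OF g] A(1)] A(1) by (simp add: emeasure_distr[OF t])
  qed simp
  then show ?thesis
    using nn_integral_distr[OF t, of f] f by simp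
qed

text \<open>Finitely many left translates of a nonempty open set cover a compact set of positive
  measure.\<close>

lemma haar_open_positive:
  assumes l: "left_haar_measure G T l" and W: "openin T W" "w \<in> W"
  shows "emeasure l W \<noteq> 0"
proof
  assume null: "emeasure l W = 0"
  obtain K where K: "compactin T K" "emeasure l K \<noteq> 0"
    using haar_compact_positive[OF l] .
  have K_sub: "K \<subseteq> carrier G"
    using compactin_subset_topspace[OF K(1)] by (simp add: topspace_eq_carrier)
  have W_sub: "W \<subseteq> carrier G"
    using openin_subset[OF W(1)] by (simp add: topspace_eq_carrier)
  have w: "w \<in> carrier G"
    using W W_sub by blast
  define V where "V x = (x \<otimes> inv w) <# W" for x
  have V_open: "openin T (V x)" if "x \<in> K" for x
  proof -
    have x: "x \<otimes> inv w \<in> carrier G"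
      using that K_sub w by blast
    have "openin T {y \<in> topspace T. inv (x \<otimes> inv w) \<otimes> y \<in> W}"
      by (rule openin_continuous_map_preimage[OF _ W(1)])
         (intro continuous_map_group_mult continuous_map_group_const inv_closed x
           continuous_map_id[unfolded id_def])
    then show ?thesis
      unfolding V_def l_coset_eq_vimage[OF x W_sub] by (simp add: topspace_eq_carrier)
  qed
  have V_null: "V x \<in> null_sets l" if "x \<in> K" for x
  proof (rule null_setsI)
    have "x \<otimes> inv w \<in> carrier G"
      using that K_sub w by blast
    moreover have "W \<in> sets l"
      using W(1) by (simp add: left_haar_measure_sets(1)[OF l] openin_imp_sets_borel_algebra)
    ultimately show "emeasure l (V x) = 0"
      using l null by (simp add: left_haar_measure_def V_def)
    show "V x \<in> sets l"
      using V_open[OF that]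
      by (simp add: left_haar_measure_sets(1)[OF l] openin_imp_sets_borel_algebra)
  qed
  have "x \<in> V x" if "x \<in> K" for x
  proof -
    have "x = (x \<otimes> inv w) \<otimes> w"
      using that K_sub w by (auto simp: m_assoc)
    then show ?thesis
      unfolding V_def l_coset_def using W(2) by blast
  qed
  then have cover: "K \<subseteq> \<Union>(V ` K)"
    by blast
  from compactinD[OF K(1) _ cover] obtain \<F> where "finite \<F>" "\<F> \<subseteq> V ` K" "K \<subseteq> \<Union>\<F>"
    using V_open by auto
  then obtain F where F: "finite F" "F \<subseteq> K" "K \<subseteq> (\<Union>x\<in>F. V x)"
    by (metis finite_subset_image)
  have "(\<Union>x\<in>F. V x) \<in> null_sets l"
    using F V_null by (intro null_sets.finite_UN) auto
  then have "emeasure l (\<Union>x\<in>F. V x) = 0"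
    by auto
  moreover have "emeasure l K \<le> emeasure l (\<Union>x\<in>F. V x)"
    using F(3) \<open>(\<Union>x\<in>F. V x) \<in> null_sets l\<close> by (intro emeasure_mono) auto
  ultimately show False
    using K(2) by simp
qed

lemma haar_sigma_finite:
  assumes l: "left_haar_measure G T l" and "locally_compact_space T" "second_countable T"
  shows "sigma_finite_measure l"
proof -
  obtain \<L> where \<L>: "countable \<L>"
    "\<And>V L. (V, L) \<in> \<L> \<Longrightarrow> openin T V \<and> compactin T L \<and> V \<subseteq> L"
    "\<And>K F. compactin T K \<Longrightarrow> closedin T F \<Longrightarrow> K \<inter> F = {} \<Longrightarrow>
       \<exists>V L. (V, L) \<in> \<L> \<and> K \<subseteq> V \<and> L \<inter> F = {}"
    using countable_compact_separation[OF assms(2) Hausdorff assms(3)] by metis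
  show ?thesis
  proof (unfold_locales, intro exI conjI)
    show "countable (snd ` \<L>)"
      using \<L>(1) by simp
    have compact: "compactin T L" if "L \<in> snd ` \<L>" for L
      using that \<L>(2) by auto
    show "snd ` \<L> \<subseteq> sets l"
      using haar_compact_sets[OF l compact] by (rule subsetI)
    show "\<forall>L\<in>snd ` \<L>. emeasure l L \<noteq> \<infinity>"
      using haar_compact_finite[OF l compact] by (simp add: less_top)
    show "\<Union>(snd ` \<L>) = space l"
    proof
      show "\<Union>(snd ` \<L>) \<subseteq> space l"
        using \<open>snd ` \<L> \<subseteq> sets l\<close> sets.sets_into_space by blast
      show "space l \<subseteq> \<Union>(snd ` \<L>)"
      proof
        fix x assume "x \<in> space l"
        then have "compactin T {x}"
          by (simp add: left_haar_measure_sets(2)[OF l] topspace_eq_carrier)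
        from \<L>(3)[OF this closedin_empty] obtain V L where "(V, L) \<in> \<L>" "{x} \<subseteq> V"
          by auto
        with \<L>(2)[OF this(1)] show "x \<in> \<Union>(snd ` \<L>)"
          by (intro UnionI[of L]) (auto intro: rev_image_eqI)
      qed
    qed
  qed
qed

text \<open>The modular function is lower semicontinuous because Haar measure is outer regular: the
  right translates \<open>K #> g\<close> of a compact set by elements near \<open>g\<^sub>0\<close> stay inside an open set
  that is hardly larger than \<open>K #> g\<^sub>0\<close>, so their measure cannot jump up, and this measure
  is inversely proportional to \<open>\<mu> g\<close>.\<close>

lemma openin_modular_superlevel:
  assumes l: "left_haar_measure G T l"
    and scale: "\<And>g S. g \<in> carrier G \<Longrightarrow> S \<in> sets l \<Longrightarrow>
      emeasure l S = ennreal (\<mu> g) * emeasure l (S #> g)"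
    and pos: "\<And>g. g \<in> carrier G \<Longrightarrow> \<mu> g > 0" and c: "c > (0::real)"
  shows "openin T {g \<in> carrier G. c < \<mu> g}"
proof (subst openin_subopen, safe)
  fix g\<^sub>0 assume g0: "g\<^sub>0 \<in> carrier G" "c < \<mu> g\<^sub>0"
  obtain K where K: "compactin T K" "emeasure l K \<noteq> 0"
    using haar_compact_positive[OF l] .
  have K_fin: "emeasure l (K #> g) < \<infinity>" and K_sets: "K #> g \<in> sets l" if "g \<in> carrier G" for g
    using haar_compact_finite[OF l] haar_compact_sets[OF l] compactin_r_coset[OF K(1) that]
    by auto
  define k where "k = enn2real (emeasure l K)"
  have k: "emeasure l K = ennreal k" "k > 0"
    using haar_compact_finite[OF l K(1)] K(2)
    by (auto simp: k_def enn2real_positive_iff less_top zero_less_iff_neq_zero)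
  define k\<^sub>0 where "k\<^sub>0 = enn2real (emeasure l (K #> g\<^sub>0))"
  have k0: "emeasure l (K #> g\<^sub>0) = ennreal k\<^sub>0" "k\<^sub>0 \<ge> 0"
    using K_fin[OF g0(1)] by (auto simp: k\<^sub>0_def less_top)
  have "ennreal k = ennreal (\<mu> g\<^sub>0 * k\<^sub>0)"
    using scale[OF g0(1) haar_compact_sets[OF l K(1)]] pos[OF g0(1)] k k0
    by (simp add: ennreal_mult)
  then have "k = \<mu> g\<^sub>0 * k\<^sub>0"
    using k k0 pos[OF g0(1)] by (simp add: ennreal_inj)
  then have "c * k\<^sub>0 < k"
    using k(2) k0(2) g0(2) c by (metis mult_strict_right_mono mult_zero_right order_le_less)
  then have "k\<^sub>0 < k / c"
    using c by (simp add: pos_less_divide_eq mult.commute)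
  then have "emeasure l (K #> g\<^sub>0) < ennreal (k / c)"
    using k0 by (simp add: ennreal_less_iff)
  moreover have "emeasure l (K #> g\<^sub>0) = (INF U \<in> {U. openin T U \<and> K #> g\<^sub>0 \<subseteq> U}. emeasure l U)"
    using l K_sets[OF g0(1)] by (simp add: left_haar_measure_def radon_measure_def)
  ultimately obtain U where U: "openin T U" "K #> g\<^sub>0 \<subseteq> U" "emeasure l U < ennreal (k / c)"
    by (auto simp: INF_less_iff)
  have "continuous_map (prod_topology T T) T (\<lambda>(g, x). x \<otimes> g)"
    using continuous_map_group_mult[OF continuous_map_snd continuous_map_fst]
    by (simp add: split_def)
  from openin_uniformly_on_compact[OF this K(1) U(1)]
  have "openin T {g \<in> carrier G. K #> g \<subseteq> U}"
    by (simp add: topspace_eq_carrier r_coset_def subset_eq)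
  moreover have "g\<^sub>0 \<in> {g \<in> carrier G. K #> g \<subseteq> U}"
    using g0 U by blast
  moreover have "{g \<in> carrier G. K #> g \<subseteq> U} \<subseteq> {g \<in> carrier G. c < \<mu> g}"
  proof safe
    fix g assume g: "g \<in> carrier G" "K #> g \<subseteq> U"
    define u where "u = enn2real (emeasure l U)"
    have u: "emeasure l U = ennreal u" "u \<ge> 0"
      using U(3) by (auto simp: u_def ennreal_enn2real_if dest: less_trans[OF _ ennreal_less_top])
    have "ennreal k \<le> ennreal (\<mu> g) * emeasure l U"
      using scale[OF g(1) haar_compact_sets[OF l K(1)]] k(1) g(2) U(1)
      by (simp add: emeasure_mono mult_left_mono left_haar_measure_sets(1)[OF l]
          openin_imp_sets_borel_algebra)
    then have "k \<le> \<mu> g * u"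
      using pos[OF g(1)] u by (simp add: ennreal_mult[symmetric])
    moreover have "c * u < k"
      using U(3) u c by (simp add: ennreal_less_iff pos_less_divide_eq mult.commute)
    ultimately have "c * u < \<mu> g * u"
      by linarith
    then show "c < \<mu> g"
      using u(2) mult_right_less_imp_less by blast
  qed
  ultimately show "\<exists>U. openin T U \<and> g\<^sub>0 \<in> U \<and> U \<subseteq> {g \<in> carrier G. c < \<mu> g}"
    by blast
qed

end

section \<open>Coset-preserving maps for a unimodular subgroup\<close>

context topological_group
begin

text \<open>Unimodularity of \<open>H\<close> matters because of this fact. On each coset \<open>H #> g\<close> the map \<open>\<rho>\<close>
  is a right translation, so it preserves the copy of the Haar measure \<open>\<eta>\<close> of \<open>H\<close> on that
  coset as soon as \<open>\<eta>\<close> is right invariant; and \<open>l\<close> is a superposition of these copies.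

  Instead of a quotient measure on the space of cosets, the proof uses the weight \<open>Q g\<close>, the
  \<open>\<eta>\<close>-measure of the part of \<open>H #> g\<close> inside \<open>W\<close>. Unfolding \<open>Q\<close>, exchanging the
  integrals and translating by elements of \<open>H\<close> turns the integral of \<open>Q g * f (\<rho> g)\<close> into an
  expression that does not mention \<open>\<rho>\<close>. Right invariance of \<open>\<eta>\<close> makes \<open>Q\<close> constant on
  cosets, so the weight can be divided out again. It is finite since \<open>W\<close> lies in a compact set,
  and it is positive on \<open>W\<close>, outside which \<open>f\<close> vanishes.\<close>

lemma nn_integral_orbit_map:
  assumes lc: "locally_compact_space T" and sc: "second_countable T"
    and l: "left_haar_measure G T l"
    and H: "subgroup H G" "closedin T H"
    and uni: "unimodular (G\<lparr>carrier := H\<rparr>) (subtopology T H)"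
    and \<rho>: "\<rho> \<in> measurable l l"
    and \<rho>_equiv: "\<And>h g. h \<in> H \<Longrightarrow> g \<in> carrier G \<Longrightarrow> \<rho> (h \<otimes> g) = h \<otimes> \<rho> g"
    and \<rho>_coset: "\<And>g. g \<in> carrier G \<Longrightarrow> \<rho> g \<in> H #> g"
    and W: "openin T W" "W \<subseteq> C" "compactin T C"
    and f: "f \<in> borel_measurable l" "\<And>g. g \<in> carrier G \<Longrightarrow> g \<notin> W \<Longrightarrow> f g = 0"
  shows "(\<integral>\<^sup>+g. f (\<rho> g) \<partial>l) = (\<integral>\<^sup>+g. f g \<partial>l)"
proof -
  let ?H = "G\<lparr>carrier := H\<rparr>" and ?TH = "subtopology T H"
  interpret H: topological_group ?H ?TH
    using H(1) by (rule topological_group_subgroup)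
  obtain \<eta> where \<eta>: "left_haar_measure ?H ?TH \<eta>"
    and \<eta>_right: "\<And>g S. g \<in> H \<Longrightarrow> S \<in> sets \<eta> \<Longrightarrow> emeasure \<eta> S = emeasure \<eta> (S #>\<^bsub>?H\<^esub> g)"
    using uni unfolding unimodular_def is_modular_function_def by auto
  have H_sub: "H \<subseteq> carrier G"
    using H(1) by (rule subgroup.subset)
  have space_l [simp]: "space l = carrier G"
    using left_haar_measure_sets(2)[OF l] .
  have space_\<eta> [simp]: "space \<eta> = H"
    using H.left_haar_measure_sets(2)[OF \<eta>] by simp
  have lc_H: "locally_compact_space ?TH"
    using lc H(2) by (rule locally_compact_space_closed_subset)
  have sc_H: "second_countable ?TH"
    using sc by (rule second_countable_subtopology)
  interpret l: sigma_finite_measure l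
    using haar_sigma_finite[OF l lc sc] .
  interpret \<eta>: sigma_finite_measure \<eta>
    using H.haar_sigma_finite[OF \<eta> lc_H sc_H] .
  interpret P: pair_sigma_finite \<eta> l ..
  have sets_P: "sets (\<eta> \<Otimes>\<^sub>M l) = sets (borel_algebra ?TH \<Otimes>\<^sub>M borel_algebra T)"
    by (intro sets_pair_measure_cong H.left_haar_measure_sets(1)[OF \<eta>] left_haar_measure_sets(1)[OF l])
  have cont_H: "continuous_map (prod_topology ?TH T) T fst"
    using continuous_map_into_fulltopology[OF continuous_map_fst[of ?TH T]] .
  have meas_P: "\<phi> \<in> measurable (\<eta> \<Otimes>\<^sub>M l) l" if "continuous_map (prod_topology ?TH T) T \<phi>" for \<phi>
    using continuous_map_prod_measurable[OF sc_H sc that]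
    by (simp add: measurable_cong_sets[OF sets_P left_haar_measure_sets(1)[OF l]])
  have mult: "(\<lambda>p. fst p \<otimes> snd p) \<in> measurable (\<eta> \<Otimes>\<^sub>M l) l"
    by (intro meas_P continuous_map_group_mult cont_H continuous_map_snd)
  have inv_mult: "(\<lambda>p. inv (fst p) \<otimes> snd p) \<in> measurable (\<eta> \<Otimes>\<^sub>M l) l"
    by (intro meas_P continuous_map_group_mult continuous_map_group_inv cont_H continuous_map_snd)
  have W_sets: "W \<in> sets l"
    using W(1) by (simp add: left_haar_measure_sets(1)[OF l] openin_imp_sets_borel_algebra)
  have ind_W: "indicator W \<in> borel_measurable l"
    using W_sets by simp
  have ind_mult: "(\<lambda>p. indicator W (fst p \<otimes> snd p) :: ennreal) \<in> borel_measurable (\<eta> \<Otimes>\<^sub>M l)"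
    using measurable_compose[OF mult ind_W] .
  define Q :: "'a \<Rightarrow> ennreal" where "Q g = (\<integral>\<^sup>+h. indicator W (h \<otimes> g) \<partial>\<eta>)" for g
  have swap: "(\<lambda>p. (snd p, fst p)) \<in> measurable (l \<Otimes>\<^sub>M \<eta>) (\<eta> \<Otimes>\<^sub>M l)"
    by simp
  have Q_meas: "Q \<in> borel_measurable l"
    unfolding Q_def
    using \<eta>.borel_measurable_nn_integral[of "\<lambda>g h. indicator W (h \<otimes> g)" l]
      measurable_compose[OF swap ind_mult]
    by (simp add: split_def)
  have slice: "(\<lambda>h. indicator W (h \<otimes> g) :: ennreal) \<in> borel_measurable \<eta>" if "g \<in> carrier G" for g
    using measurable_compose[OF measurable_Pair2'[of g l \<eta>] ind_mult] that by simp
  have Q_right: "Q (h \<otimes> g) = Q g" if h: "h \<in> H" and g: "g \<in> carrier G" for h g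
  proof -
    have "Q (h \<otimes> g) = (\<integral>\<^sup>+h'. indicator W ((h' \<otimes>\<^bsub>?H\<^esub> h) \<otimes> g) \<partial>\<eta>)"
      unfolding Q_def using h g by (intro nn_integral_cong) (simp add: m_assoc subsetD[OF H_sub])
    also have "\<dots> = Q g"
      unfolding Q_def
      using H.nn_integral_haar_right_translate[OF \<eta>, of h "\<lambda>h'. indicator W (h' \<otimes> g)"]
        \<eta>_right h slice[OF g] by simp
    finally show ?thesis .
  qed
  have Q_\<rho>: "Q (\<rho> g) = Q g" and \<rho>_carrier: "\<rho> g \<in> carrier G" if g: "g \<in> carrier G" for g
  proof -
    obtain h where h: "h \<in> H" "\<rho> g = h \<otimes> g"
      using \<rho>_coset[OF g] by (auto simp: r_coset_def)
    then show "Q (\<rho> g) = Q g"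
      using Q_right[OF h(1) g] by simp
    show "\<rho> g \<in> carrier G"
      using h g H_sub by auto
  qed
  have Q_eq: "Q g = emeasure \<eta> {h \<in> H. h \<otimes> g \<in> W}"
    and Q_sets: "{h \<in> H. h \<otimes> g \<in> W} \<in> sets \<eta>"
    and Q_open: "openin ?TH {h \<in> H. h \<otimes> g \<in> W}" if g: "g \<in> carrier G" for g
  proof -
    have "continuous_map ?TH T (\<lambda>h. h \<otimes> g)"
      by (intro continuous_map_group_mult continuous_map_group_const g
          continuous_map_from_subtopology continuous_map_id[unfolded id_def])
    from openin_continuous_map_preimage[OF this W(1)]
    show op: "openin ?TH {h \<in> H. h \<otimes> g \<in> W}"
      using H_sub by (simp add: topspace_eq_carrier Int_absorb1)
    then show s: "{h \<in> H. h \<otimes> g \<in> W} \<in> sets \<eta>"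
      by (simp add: H.left_haar_measure_sets(1)[OF \<eta>] openin_imp_sets_borel_algebra)
    have "Q g = (\<integral>\<^sup>+h. indicator {h \<in> H. h \<otimes> g \<in> W} h \<partial>\<eta>)"
      unfolding Q_def by (intro nn_integral_cong) (simp add: indicator_def)
    then show "Q g = emeasure \<eta> {h \<in> H. h \<otimes> g \<in> W}"
      using s by simp
  qed
  have Q_finite: "Q g \<noteq> \<infinity>" if g: "g \<in> carrier G" for g
  proof -
    have C: "C \<subseteq> carrier G"
      using compactin_subset_topspace[OF W(3)] by (simp add: topspace_eq_carrier)
    define B where "B = (C #> inv g) \<inter> H"
    have "compactin T B"
      unfolding B_def using compactin_r_coset[OF W(3)] g H(2) by (intro compact_Int_closedin) auto
    then have B: "compactin ?TH B"
      by (simp add: compactin_subtopology B_def)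
    have "{h \<in> H. h \<otimes> g \<in> W} \<subseteq> B"
      using W(2) H_sub g by (auto simp: B_def r_coset_eq_vimage[OF inv_closed[OF g] C])
    then have "Q g \<le> emeasure \<eta> B"
      unfolding Q_eq[OF g] using H.haar_compact_sets[OF \<eta> B] by (intro emeasure_mono)
    then show ?thesis
      using H.haar_compact_finite[OF \<eta> B] by (auto simp: top_unique)
  qed
  have Q_positive: "Q g \<noteq> 0" if "g \<in> carrier G" "g \<in> W" for g
    using H.haar_open_positive[OF \<eta> Q_open[OF that(1)], of \<one>] that subgroup.one_closed[OF H(1)]
    by (simp add: Q_eq)
  \<comment> \<open>Stated for an arbitrary map \<open>r\<close>, to be used for \<open>\<rho>\<close> and for the identity.\<close>
  have weighted: "(\<integral>\<^sup>+g. Q g * \<phi> (r g) \<partial>l) = (\<integral>\<^sup>+g. (\<integral>\<^sup>+h. indicator W g * \<phi> (inv h \<otimes> g) \<partial>\<eta>) \<partial>l)"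
    if \<phi>: "\<phi> \<in> borel_measurable l" and r: "r \<in> measurable l l"
      and r_equiv: "\<And>h g. h \<in> H \<Longrightarrow> g \<in> carrier G \<Longrightarrow> r (h \<otimes> g) = h \<otimes> r g"
      and r_coset: "\<And>g. g \<in> carrier G \<Longrightarrow> r g \<in> H #> g" for \<phi> r
  proof -
    have r_carrier: "r g \<in> carrier G" if "g \<in> carrier G" for g
      using measurable_space[OF r, of g] that by simp
    have \<phi>_r: "(\<lambda>g. \<phi> (r g)) \<in> borel_measurable l"
      using measurable_compose[OF r \<phi>] .
    have meas1: "(\<lambda>(h, g). indicator W (h \<otimes> g) * \<phi> (r g)) \<in> borel_measurable (\<eta> \<Otimes>\<^sub>M l)"
      unfolding split_def
      by (intro borel_measurable_times_ennreal ind_mult measurable_compose[OF measurable_snd \<phi>_r])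
    have "(\<lambda>p. \<phi> (inv (fst p) \<otimes> r (snd p))) \<in> borel_measurable (\<eta> \<Otimes>\<^sub>M l)"
    proof -
      have "(\<lambda>p. (fst p, r (snd p))) \<in> measurable (\<eta> \<Otimes>\<^sub>M l) (\<eta> \<Otimes>\<^sub>M l)"
        using r by measurable
      from measurable_compose[OF measurable_compose[OF this inv_mult] \<phi>] show ?thesis
        by simp
    qed
    then have meas2: "(\<lambda>(h, g). indicator W g * \<phi> (inv h \<otimes> r g)) \<in> borel_measurable (\<eta> \<Otimes>\<^sub>M l)"
      unfolding split_def
      by (intro borel_measurable_times_ennreal measurable_compose[OF measurable_snd ind_W])
    have "(\<integral>\<^sup>+g. Q g * \<phi> (r g) \<partial>l) = (\<integral>\<^sup>+g. (\<integral>\<^sup>+h. indicator W (h \<otimes> g) * \<phi> (r g) \<partial>\<eta>) \<partial>l)"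
      unfolding Q_def using slice by (intro nn_integral_cong nn_integral_multc[symmetric]) simp
    also have "\<dots> = (\<integral>\<^sup>+h. (\<integral>\<^sup>+g. indicator W (h \<otimes> g) * \<phi> (r g) \<partial>l) \<partial>\<eta>)"
      using P.Fubini'[OF meas1] .
    also have "\<dots> = (\<integral>\<^sup>+h. (\<integral>\<^sup>+g. indicator W g * \<phi> (inv h \<otimes> r g) \<partial>l) \<partial>\<eta>)"
    proof (rule nn_integral_cong)
      fix h assume "h \<in> space \<eta>"
      then have h: "h \<in> H" "h \<in> carrier G" "inv h \<in> H"
        using H_sub subgroup.m_inv_closed[OF H(1)] by auto
      have "(\<lambda>g. indicator W (h \<otimes> g) * \<phi> (r g)) \<in> borel_measurable l"
        using measurable_compose[OF measurable_Pair1'[of h \<eta> l] meas1] h by simp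
      from nn_integral_haar_left_translate[OF l inv_closed[OF h(2)] this, symmetric]
      have "(\<integral>\<^sup>+g. indicator W (h \<otimes> g) * \<phi> (r g) \<partial>l) =
          (\<integral>\<^sup>+g. indicator W (h \<otimes> (inv h \<otimes> g)) * \<phi> (r (inv h \<otimes> g)) \<partial>l)" .
      also have "\<dots> = (\<integral>\<^sup>+g. indicator W g * \<phi> (inv h \<otimes> r g) \<partial>l)"
        using h by (intro nn_integral_cong) (simp add: r_equiv m_assoc[symmetric])
      finally show "(\<integral>\<^sup>+g. indicator W (h \<otimes> g) * \<phi> (r g) \<partial>l) =
          (\<integral>\<^sup>+g. indicator W g * \<phi> (inv h \<otimes> r g) \<partial>l)" .
    qed
    also have "\<dots> = (\<integral>\<^sup>+g. (\<integral>\<^sup>+h. indicator W g * \<phi> (inv h \<otimes> r g) \<partial>\<eta>) \<partial>l)"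
      using P.Fubini'[OF meas2, symmetric] .
    also have "\<dots> = (\<integral>\<^sup>+g. (\<integral>\<^sup>+h. indicator W g * \<phi> (inv h \<otimes> g) \<partial>\<eta>) \<partial>l)"
    proof (rule nn_integral_cong)
      fix g assume "g \<in> space l"
      then have g: "g \<in> carrier G"
        by simp
      obtain k where k: "k \<in> H" "r g = k \<otimes> g"
        using r_coset[OF g] by (auto simp: r_coset_def)
      have k': "inv k \<in> H" "k \<in> carrier G"
        using subgroup.m_inv_closed[OF H(1) k(1)] k(1) H_sub by auto
      define \<psi> where "\<psi> h = indicator W g * \<phi> (inv h \<otimes> r g)" for h
      have "\<psi> \<in> borel_measurable \<eta>"
        using measurable_compose[OF measurable_Pair2'[of g l \<eta>] meas2] g
        by (simp add: \<psi>_def[abs_def])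
      from H.nn_integral_haar_left_translate[OF \<eta> _ this, of k] k(1)
      have "(\<integral>\<^sup>+h. \<psi> h \<partial>\<eta>) = (\<integral>\<^sup>+h. \<psi> (k \<otimes> h) \<partial>\<eta>)"
        by simp
      also have "\<dots> = (\<integral>\<^sup>+h. indicator W g * \<phi> (inv h \<otimes> g) \<partial>\<eta>)"
      proof (rule nn_integral_cong)
        fix h assume "h \<in> space \<eta>"
        then have h: "h \<in> carrier G"
          using H_sub by auto
        have "inv (k \<otimes> h) \<otimes> (k \<otimes> g) = inv h \<otimes> g"
          using h g k'(2) by (simp add: inv_mult_group m_assoc inv_solve_left')
        then show "\<psi> (k \<otimes> h) = indicator W g * \<phi> (inv h \<otimes> g)"
          by (simp add: \<psi>_def k(2))
      qed
      finally show "(\<integral>\<^sup>+h. indicator W g * \<phi> (inv h \<otimes> r g) \<partial>\<eta>) =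
          (\<integral>\<^sup>+h. indicator W g * \<phi> (inv h \<otimes> g) \<partial>\<eta>)"
        by (simp add: \<psi>_def)
    qed
    finally show ?thesis .
  qed
  define \<phi> where "\<phi> g = f g / Q g" for g
  have \<phi>: "\<phi> \<in> borel_measurable l"
    unfolding \<phi>_def using f(1) Q_meas by measurable
  have unweight: "Q g * \<phi> g = f g" if "g \<in> carrier G" for g
  proof (cases "g \<in> W")
    case True
    then show ?thesis
      using Q_positive[OF that True] Q_finite[OF that]
      by (simp add: \<phi>_def ennreal_times_divide mult.commute[of "Q g"] mult_divide_eq_ennreal)
  next
    case False
    then show ?thesis
      using f(2)[OF that] by (simp add: \<phi>_def)
  qed
  have "(\<integral>\<^sup>+g. f (\<rho> g) \<partial>l) = (\<integral>\<^sup>+g. Q g * \<phi> (\<rho> g) \<partial>l)"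
    using unweight \<rho>_carrier Q_\<rho> by (intro nn_integral_cong) (metis space_l)
  also have "\<dots> = (\<integral>\<^sup>+g. (\<integral>\<^sup>+h. indicator W g * \<phi> (inv h \<otimes> g) \<partial>\<eta>) \<partial>l)"
    using weighted[OF \<phi> \<rho> \<rho>_equiv \<rho>_coset] .
  also have "\<dots> = (\<integral>\<^sup>+g. Q g * \<phi> g \<partial>l)"
  proof (rule weighted[OF \<phi>, of "\<lambda>g. g", symmetric])
    show "g \<in> H #> g" if "g \<in> carrier G" for g
      using that subgroup.one_closed[OF H(1)] by (force simp: r_coset_def)
  qed simp_all
  also have "\<dots> = (\<integral>\<^sup>+g. f g \<partial>l)"
    using unweight by (intro nn_integral_cong) simp
  finally show ?thesis .
qed

end

section \<open>The Chabauty Borel structure\<close>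

context topological_group
begin

abbreviation avoiding :: "'a set \<Rightarrow> 'a set set" where
  "avoiding K \<equiv> {H \<in> closed_subgroups G T. H \<inter> K = {}}"

lemma openin_chabauty_avoiding:
  "compactin T K \<Longrightarrow> openin (chabauty_topology G T) (avoiding K)"
  unfolding chabauty_topology_def
  by (rule topology_generated_by_Basis) blast

lemma openin_chabauty_meeting:
  "openin T U \<Longrightarrow> openin (chabauty_topology G T) {H \<in> closed_subgroups G T. H \<inter> U \<noteq> {}}"
  unfolding chabauty_topology_def
  by (rule topology_generated_by_Basis) blast

text \<open>The Chabauty topology is second countable: the countably many separating pairs
  \<open>(V, L)\<close> yield the subbasis of the sets of subgroups that avoid \<open>L\<close> or meet \<open>V\<close>. The
  condition of meeting the open set \<open>V\<close> can in turn be expressed by the compact sets \<open>L\<close>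
  inside \<open>V\<close>. So the conditions of avoiding compact sets generate the Borel algebra.\<close>

lemma measurable_into_chabauty:
  assumes lc: "locally_compact_space T" and sc: "second_countable T"
    and f: "\<And>x. x \<in> space M \<Longrightarrow> f x \<in> closed_subgroups G T"
    and avoid: "\<And>K. compactin T K \<Longrightarrow> {x \<in> space M. f x \<inter> K = {}} \<in> sets M"
  shows "f \<in> measurable M (borel_algebra (chabauty_topology G T))"
proof (rule measurable_borel_algebraI)
  show "f \<in> space M \<rightarrow> topspace (chabauty_topology G T)"
    using f by (simp add: topspace_chabauty_topology)
  obtain \<L> where \<L>: "countable \<L>"
    "\<And>V L. (V, L) \<in> \<L> \<Longrightarrow> openin T V \<and> compactin T L \<and> V \<subseteq> L"
    "\<And>K F. compactin T K \<Longrightarrow> closedin T F \<Longrightarrow> K \<inter> F = {} \<Longrightarrow>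
       \<exists>V L. (V, L) \<in> \<L> \<and> K \<subseteq> V \<and> L \<inter> F = {}"
    using countable_compact_separation[OF lc Hausdorff sc] by metis
  have point: "\<exists>V L. (V, L) \<in> \<L> \<and> x \<in> V \<and> L \<subseteq> U" if U: "openin T U" and x: "x \<in> U" for U x
  proof -
    have U_sub: "U \<subseteq> topspace T"
      using U by (rule openin_subset)
    have "compactin T {x}"
      using x U_sub by auto
    moreover have "closedin T (topspace T - U)"
      using U by blast
    moreover have "{x} \<inter> (topspace T - U) = {}"
      using x by simp
    ultimately obtain V L where VL: "(V, L) \<in> \<L>" "{x} \<subseteq> V" "L \<inter> (topspace T - U) = {}"
      using \<L>(3) by metis
    have "L \<subseteq> topspace T"
      using \<L>(2)[OF VL(1)] by (simp add: compactin_subset_topspace)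
    then have "L \<subseteq> U"
      using VL(3) by auto
    with VL show ?thesis
      by auto
  qed
  have meet: "{x \<in> space M. f x \<inter> U \<noteq> {}} \<in> sets M" if U: "openin T U" for U
  proof -
    define \<L>' where "\<L>' = {p \<in> \<L>. snd p \<subseteq> U}"
    have "countable \<L>'"
      using \<L>(1) unfolding \<L>'_def by (rule countable_subset[rotated]) simp
    moreover have "space M - {x \<in> space M. f x \<inter> snd p = {}} \<in> sets M" if "p \<in> \<L>'" for p
      using that \<L>(2)[of "fst p" "snd p"] avoid by (simp add: \<L>'_def)
    ultimately have "(\<Union>p\<in>\<L>'. space M - {x \<in> space M. f x \<inter> snd p = {}}) \<in> sets M"
      by (rule sets.countable_UN'')
    moreover have "{x \<in> space M. f x \<inter> U \<noteq> {}} = (\<Union>p\<in>\<L>'. space M - {x \<in> space M. f x \<inter> snd p = {}})"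
    proof (intro equalityI subsetI)
      fix x assume "x \<in> {x \<in> space M. f x \<inter> U \<noteq> {}}"
      then obtain y where x: "x \<in> space M" "y \<in> f x" "y \<in> U"
        by auto
      obtain V L where VL: "(V, L) \<in> \<L>" "y \<in> V" "L \<subseteq> U"
        using point[OF U x(3)] by auto
      then have "y \<in> f x \<inter> L"
        using \<L>(2)[OF VL(1)] x by auto
      with VL x show "x \<in> (\<Union>p\<in>\<L>'. space M - {x \<in> space M. f x \<inter> snd p = {}})"
        by (intro UN_I[of "(V, L)"]) (auto simp: \<L>'_def)
    next
      fix x assume "x \<in> (\<Union>p\<in>\<L>'. space M - {x \<in> space M. f x \<inter> snd p = {}})"
      then show "x \<in> {x \<in> space M. f x \<inter> U \<noteq> {}}"
        unfolding \<L>'_def by auto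
    qed
    ultimately show ?thesis
      by simp
  qed
  \<comment> \<open>Finite intersections of subbasic sets, indexed by the pairs to avoid and to meet\<close>
  define E :: "('a set \<times> 'a set) set \<times> ('a set \<times> 'a set) set \<Rightarrow> 'a set set" where "E = (\<lambda>(A, B). {H \<in> closed_subgroups G T.
    (\<forall>p\<in>A. H \<inter> snd p = {}) \<and> (\<forall>p\<in>B. H \<inter> fst p \<noteq> {})})"
  define I where "I = Fpow \<L> \<times> Fpow \<L>"
  have I: "countable I"
    unfolding I_def by (intro countable_SIGMA countable_Fpow \<L>(1))
  have E_meas: "{x \<in> space M. f x \<in> E i} \<in> sets M" if "i \<in> I" for i
  proof -
    obtain A B where i: "i = (A, B)" "finite A" "A \<subseteq> \<L>" "finite B" "B \<subseteq> \<L>"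
      using \<open>i \<in> I\<close> by (auto simp: I_def Fpow_def)
    have "{x \<in> space M. \<forall>p\<in>A. f x \<inter> snd p = {}} \<in> sets M"
    proof (rule sets.sets_Collect_finite_All[OF _ i(2)])
      fix p assume "p \<in> A"
      then have "compactin T (snd p)"
        using \<L>(2)[of "fst p" "snd p"] i(3) by auto
      then show "{x \<in> space M. f x \<inter> snd p = {}} \<in> sets M"
        by (rule avoid)
    qed
    moreover have "{x \<in> space M. \<forall>p\<in>B. f x \<inter> fst p \<noteq> {}} \<in> sets M"
    proof (rule sets.sets_Collect_finite_All[OF _ i(4)])
      fix p assume "p \<in> B"
      then have "openin T (fst p)"
        using \<L>(2)[of "fst p" "snd p"] i(5) by auto
      then show "{x \<in> space M. f x \<inter> fst p \<noteq> {}} \<in> sets M"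
        by (rule meet)
    qed
    ultimately have "{x \<in> space M. \<forall>p\<in>A. f x \<inter> snd p = {}} \<inter>
        {x \<in> space M. \<forall>p\<in>B. f x \<inter> fst p \<noteq> {}} \<in> sets M"
      by (rule sets.Int)
    moreover have "{x \<in> space M. f x \<in> E i} = {x \<in> space M. \<forall>p\<in>A. f x \<inter> snd p = {}} \<inter>
        {x \<in> space M. \<forall>p\<in>B. f x \<inter> fst p \<noteq> {}}"
      using f by (auto simp: E_def i(1))
    ultimately show ?thesis
      by simp
  qed
  have base: "\<exists>i\<in>I. H \<in> E i \<and> E i \<subseteq> U"
    if "generate_topology_on ({avoiding K | K. compactin T K} \<union>
      {{H \<in> closed_subgroups G T. H \<inter> U \<noteq> {}} | U. openin T U}) U" "H \<in> U" for U H
    using that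
  proof (induction arbitrary: H rule: generate_topology_on.induct)
    case Empty
    then show ?case by simp
  next
    case (Int a b)
    then obtain i j where ij: "i \<in> I" "H \<in> E i" "E i \<subseteq> a" "j \<in> I" "H \<in> E j" "E j \<subseteq> b"
      by (meson IntD1 IntD2)
    obtain A B A' B' where AB: "i = (A, B)" "j = (A', B')"
      by (cases i, cases j)
    have "(A \<union> A', B \<union> B') \<in> I"
      using ij(1,4) by (simp add: I_def AB Fpow_def)
    moreover have "E (A \<union> A', B \<union> B') = E i \<inter> E j"
      by (auto simp: E_def AB)
    ultimately show ?case
      using ij by (metis IntI Int_mono)
  next
    case (UN K)
    then obtain k where k: "k \<in> K" "H \<in> k"
      by auto
    from UN.IH[OF k] k(1) show ?case
      by (meson Union_upper order_trans)
  next
    case (Basis s)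
    then consider K where "compactin T K" "s = avoiding K"
      | U where "openin T U" "s = {H \<in> closed_subgroups G T. H \<inter> U \<noteq> {}}"
      by auto
    then show ?case
    proof cases
      case 1
      then have H: "H \<in> closed_subgroups G T" "closedin T H" "K \<inter> H = {}"
        using Basis.prems by (auto simp: closed_subgroups_def)
      obtain V L where VL: "(V, L) \<in> \<L>" "K \<subseteq> V" "L \<inter> H = {}"
        using \<L>(3)[OF 1(1) H(2,3)] by auto
      have "({(V, L)}, {}) \<in> I"
        using VL by (simp add: I_def Fpow_def)
      moreover have "H \<in> E ({(V, L)}, {})"
        using VL H by (auto simp: E_def)
      moreover have "E ({(V, L)}, {}) \<subseteq> s"
        using VL \<L>(2)[OF VL(1)] by (auto simp: E_def 1)
      ultimately show ?thesis
        by auto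
    next
      case 2
      then obtain x where x: "x \<in> H" "x \<in> U" and H: "H \<in> closed_subgroups G T"
        using Basis.prems by auto
      obtain V L where VL: "(V, L) \<in> \<L>" "x \<in> V" "L \<subseteq> U"
        using point[OF 2(1) x(2)] by auto
      have "({}, {(V, L)}) \<in> I"
        using VL by (simp add: I_def Fpow_def)
      moreover have "H \<in> E ({}, {(V, L)})"
        using VL x H by (auto simp: E_def)
      moreover have "E ({}, {(V, L)}) \<subseteq> s"
        using VL \<L>(2)[OF VL(1)] by (auto simp: E_def 2)
      ultimately show ?thesis
        by auto
    qed
  qed
  fix U assume "openin (chabauty_topology G T) U"
  then have U: "generate_topology_on ({avoiding K | K. compactin T K} \<union>
      {{H \<in> closed_subgroups G T. H \<inter> U \<noteq> {}} | U. openin T U}) U"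
    by (simp add: chabauty_topology_def openin_topology_generated_by_iff)
  have "U = (\<Union>i\<in>{i \<in> I. E i \<subseteq> U}. E i)"
    using base[OF U] by auto
  then have "f -` U \<inter> space M = (\<Union>i\<in>{i \<in> I. E i \<subseteq> U}. {x \<in> space M. f x \<in> E i})"
    by auto
  moreover have "\<dots> \<in> sets M"
    using E_meas I by (intro sets.countable_UN'') (auto intro: countable_subset[of _ I])
  ultimately show "f -` U \<inter> space M \<in> sets M"
    by simp
qed

lemma conjugate_eq_vimage:
  assumes "k \<in> carrier G" "H \<subseteq> carrier G"
  shows "conjugate G k H = {x \<in> carrier G. inv k \<otimes> x \<otimes> k \<in> H}"
proof -
  have "k <# H \<subseteq> carrier G"
    using assms by (rule l_coset_subset_G[rotated])
  then show ?thesis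
    using assms by (auto simp: conjugate_def r_coset_eq_vimage l_coset_eq_vimage m_assoc)
qed

lemma closed_subgroups_subset: "H \<in> closed_subgroups G T \<Longrightarrow> H \<subseteq> carrier G"
  by (simp add: closed_subgroups_def subgroup.subset)

lemma conjugate_closed_subgroup:
  assumes k: "k \<in> carrier G" and H: "H \<in> closed_subgroups G T"
  shows "conjugate G k H \<in> closed_subgroups G T"
proof -
  have subgroup: "subgroup H G" and closed: "closedin T H"
    using H by (simp_all add: closed_subgroups_def)
  have conj: "conjugate G k H = {x \<in> carrier G. inv k \<otimes> x \<otimes> k \<in> H}"
    using k closed_subgroups_subset[OF H] by (rule conjugate_eq_vimage)
  have "continuous_map T T (\<lambda>x. inv k \<otimes> x \<otimes> k)"
    by (intro continuous_map_group_mult continuous_map_group_const inv_closed k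
        continuous_map_id[unfolded id_def])
  from closedin_continuous_map_preimage[OF this closed]
  have "closedin T (conjugate G k H)"
    by (simp add: conj topspace_eq_carrier)
  moreover have "subgroup (conjugate G k H) G"
  proof (rule subgroupI)
    show "conjugate G k H \<subseteq> carrier G"
      by (auto simp: conj)
    have "\<one> \<in> conjugate G k H"
      using k subgroup.one_closed[OF subgroup] by (simp add: conj)
    then show "conjugate G k H \<noteq> {}"
      by auto
  next
    fix a assume "a \<in> conjugate G k H"
    then have a: "a \<in> carrier G" "inv k \<otimes> a \<otimes> k \<in> H"
      by (simp_all add: conj)
    have "inv (inv k \<otimes> a \<otimes> k) = inv k \<otimes> inv a \<otimes> k"
      using a(1) k by (simp add: inv_mult_group m_assoc)
    then show "inv a \<in> conjugate G k H"
      using subgroup.m_inv_closed[OF subgroup a(2)] a(1) by (simp add: conj)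
  next
    fix a b assume "a \<in> conjugate G k H" "b \<in> conjugate G k H"
    then have ab: "a \<in> carrier G" "inv k \<otimes> a \<otimes> k \<in> H" "b \<in> carrier G" "inv k \<otimes> b \<otimes> k \<in> H"
      by (simp_all add: conj)
    have "(inv k \<otimes> a \<otimes> k) \<otimes> (inv k \<otimes> b \<otimes> k) = inv k \<otimes> a \<otimes> (k \<otimes> inv k) \<otimes> b \<otimes> k"
      using ab(1,3) k by (simp only: m_assoc m_closed inv_closed)
    also have "\<dots> = inv k \<otimes> (a \<otimes> b) \<otimes> k"
      using ab(1,3) k by (simp add: m_assoc)
    finally show "a \<otimes> b \<in> conjugate G k H"
      using subgroup.m_closed[OF subgroup ab(2,4)] ab(1,3) by (simp add: conj)
  qed
  ultimately show ?thesis
    by (simp add: closed_subgroups_def)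
qed

lemma conjugate_conjugate:
  assumes "a \<in> carrier G" "b \<in> carrier G" "H \<subseteq> carrier G"
  shows "conjugate G a (conjugate G b H) = conjugate G (a \<otimes> b) H"
proof -
  have "conjugate G b H \<subseteq> carrier G"
    using assms by (auto simp: conjugate_eq_vimage)
  then show ?thesis
    using assms by (auto simp: conjugate_eq_vimage inv_mult_group m_assoc)
qed

lemma conjugate_by_member:
  assumes H: "subgroup H G" and h: "h \<in> H"
  shows "conjugate G h H = H"
proof -
  have sub: "H \<subseteq> carrier G"
    using H by (rule subgroup.subset)
  have "h <# H = H"
    using coset_join3[OF _ H h] sub h by auto
  moreover have "H #> inv h = H"
    using coset_join2[OF _ H subgroup.m_inv_closed[OF H h]] sub h by auto
  ultimately show ?thesis
    by (simp add: conjugate_def)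
qed

lemma conjugate_one: "H \<subseteq> carrier G \<Longrightarrow> conjugate G \<one> H = H"
  by (auto simp: conjugate_eq_vimage)

text \<open>The condition that the conjugate of \<open>H\<close> avoids a compact set \<open>K\<close> says that \<open>H\<close> avoids a
  conjugate of \<open>K\<close>, and one of countably many pairs \<open>(V, L)\<close> separates that conjugate from
  \<open>H\<close>; this splits the condition into countably many rectangles.\<close>

lemma measurable_conjugate:
  assumes lc: "locally_compact_space T" and sc: "second_countable T"
  shows "(\<lambda>(H, g). conjugate G (inv g) H)
    \<in> measurable (borel_algebra (chabauty_topology G T) \<Otimes>\<^sub>M borel_algebra T)
        (borel_algebra (chabauty_topology G T))" (is "_ \<in> measurable ?M _")
proof (rule measurable_into_chabauty[OF lc sc])
  have space_M: "space ?M = closed_subgroups G T \<times> carrier G"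
    by (simp add: space_pair_measure topspace_chabauty_topology topspace_eq_carrier)
  show "(case p of (H, g) \<Rightarrow> conjugate G (inv g) H) \<in> closed_subgroups G T" if "p \<in> space ?M" for p
    using that conjugate_closed_subgroup by (auto simp: space_M)
  fix K assume K: "compactin T K"
  have K_sub: "K \<subseteq> carrier G"
    using compactin_subset_topspace[OF K] by (simp add: topspace_eq_carrier)
  obtain \<L> where \<L>: "countable \<L>"
    "\<And>V L. (V, L) \<in> \<L> \<Longrightarrow> openin T V \<and> compactin T L \<and> V \<subseteq> L"
    "\<And>K F. compactin T K \<Longrightarrow> closedin T F \<Longrightarrow> K \<inter> F = {} \<Longrightarrow>
       \<exists>V L. (V, L) \<in> \<L> \<and> K \<subseteq> V \<and> L \<inter> F = {}"
    using countable_compact_separation[OF lc Hausdorff sc] by metis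
  define R where "R p = avoiding (snd p) \<times> {g \<in> topspace T. \<forall>x\<in>K. g \<otimes> x \<otimes> inv g \<in> fst p}" for p
  have "R p \<in> sets ?M" if "p \<in> \<L>" for p
  proof -
    have p: "openin T (fst p)" "compactin T (snd p)"
      using \<L>(2)[of "fst p" "snd p"] that by auto
    have "continuous_map (prod_topology T T) T (\<lambda>q. fst q \<otimes> snd q \<otimes> inv (fst q))"
      by (intro continuous_map_group_mult continuous_map_group_inv continuous_map_fst continuous_map_snd)
    from openin_uniformly_on_compact[OF this K p(1)]
    show ?thesis
      unfolding R_def using openin_chabauty_avoiding[OF p(2)]
      by (intro pair_measureI openin_imp_sets_borel_algebra) simp_all
  qed
  then have "(\<Union>p\<in>\<L>. R p) \<in> sets ?M"
    using \<L>(1) by (intro sets.countable_UN'')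
  moreover have "{p \<in> space ?M. (case p of (H, g) \<Rightarrow> conjugate G (inv g) H) \<inter> K = {}} = (\<Union>p\<in>\<L>. R p)"
  proof (intro equalityI subsetI)
    fix p assume "p \<in> {p \<in> space ?M. (case p of (H, g) \<Rightarrow> conjugate G (inv g) H) \<inter> K = {}}"
    then obtain H g where p: "p = (H, g)" "H \<in> closed_subgroups G T" "g \<in> carrier G"
      "conjugate G (inv g) H \<inter> K = {}"
      by (auto simp: space_M)
    have H: "closedin T H" "H \<subseteq> carrier G"
      using p(2) closed_subgroups_subset by (auto simp: closed_subgroups_def)
    have "continuous_map T T (\<lambda>x. g \<otimes> x \<otimes> inv g)"
      by (intro continuous_map_group_mult continuous_map_group_const inv_closed p(3)
          continuous_map_id[unfolded id_def])
    then have "compactin T ((\<lambda>x. g \<otimes> x \<otimes> inv g) ` K)"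
      using K by (rule image_compactin[rotated])
    moreover have "(\<lambda>x. g \<otimes> x \<otimes> inv g) ` K \<inter> H = {}"
      using p(3,4) H(2) K_sub by (auto simp: conjugate_eq_vimage)
    ultimately obtain V L where VL: "(V, L) \<in> \<L>" "(\<lambda>x. g \<otimes> x \<otimes> inv g) ` K \<subseteq> V" "L \<inter> H = {}"
      using \<L>(3)[OF _ H(1)] by metis
    then have "p \<in> R (V, L)"
      using p(2,3) by (auto simp: R_def p(1) topspace_eq_carrier)
    with VL(1) show "p \<in> (\<Union>p\<in>\<L>. R p)"
      by auto
  next
    fix p assume "p \<in> (\<Union>p\<in>\<L>. R p)"
    then obtain V L where VL: "(V, L) \<in> \<L>" "p \<in> R (V, L)"
      by auto
    then obtain H g where p: "p = (H, g)" "H \<in> closed_subgroups G T" "g \<in> carrier G"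
      "H \<inter> L = {}" "\<And>x. x \<in> K \<Longrightarrow> g \<otimes> x \<otimes> inv g \<in> V"
      by (auto simp: R_def topspace_eq_carrier)
    have "g \<otimes> x \<otimes> inv g \<notin> H" if "x \<in> K" for x
      using p(4) p(5)[OF that] \<L>(2)[OF VL(1)] by auto
    then have "conjugate G (inv g) H \<inter> K = {}"
      using p(2,3) closed_subgroups_subset by (auto simp: conjugate_eq_vimage)
    then show "p \<in> {p \<in> space ?M. (case p of (H, g) \<Rightarrow> conjugate G (inv g) H) \<inter> K = {}}"
      using p(2,3) by (simp add: space_M p(1))
  qed
  ultimately show "{p \<in> space ?M. (case p of (H, g) \<Rightarrow> conjugate G (inv g) H) \<inter> K = {}} \<in> sets ?M"
    by simp
qed

end

section \<open>The modular function on the support\<close>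

context topological_group
begin

lemma invariant_subgroup_measure_sets:
  assumes "invariant_subgroup_measure G T \<nu>"
  shows "sets \<nu> = sets (borel_algebra (chabauty_topology G T))"
    and "space \<nu> = closed_subgroups G T"
proof -
  show *: "sets \<nu> = sets (borel_algebra (chabauty_topology G T))"
    using assms by (simp add: invariant_subgroup_measure_def)
  show "space \<nu> = closed_subgroups G T"
    using sets_eq_imp_space_eq[OF *] by (simp add: topspace_chabauty_topology)
qed

lemma nn_integral_conjugate:
  assumes lc: "locally_compact_space T" and sc: "second_countable T"
    and \<nu>: "invariant_subgroup_measure G T \<nu>" and k: "k \<in> carrier G"
    and f: "f \<in> borel_measurable \<nu>"
  shows "(\<integral>\<^sup>+H. f (conjugate G k H) \<partial>\<nu>) = (\<integral>\<^sup>+H. f H \<partial>\<nu>)"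
proof -
  note sets_\<nu> = invariant_subgroup_measure_sets[OF \<nu>]
  have "inv k \<in> space (borel_algebra T)"
    using k by (simp add: topspace_eq_carrier)
  from measurable_compose[OF measurable_Pair2'[OF this] measurable_conjugate[OF lc sc]]
  have t: "conjugate G k \<in> measurable \<nu> \<nu>"
    using k by (simp add: measurable_cong_sets[OF sets_\<nu>(1) sets_\<nu>(1)])
  have "distr \<nu> \<nu> (conjugate G k) = \<nu>"
  proof (rule measure_eqI)
    fix A assume "A \<in> sets (distr \<nu> \<nu> (conjugate G k))"
    then have A: "A \<in> sets \<nu>" "A \<subseteq> closed_subgroups G T"
      using sets.sets_into_space[of A \<nu>] by (auto simp: sets_\<nu>(2))
    have "conjugate G k -` A \<inter> space \<nu> = conjugate G (inv k) ` A"
    proof (intro equalityI subsetI)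
      fix H assume H: "H \<in> conjugate G k -` A \<inter> space \<nu>"
      then have "H = conjugate G (inv k) (conjugate G k H)"
        using k closed_subgroups_subset[of H]
        by (simp add: conjugate_conjugate conjugate_one sets_\<nu>(2))
      then show "H \<in> conjugate G (inv k) ` A"
        using H by auto
    next
      fix H assume "H \<in> conjugate G (inv k) ` A"
      then obtain H' where H': "H' \<in> A" "H = conjugate G (inv k) H'"
        by auto
      then have "conjugate G k H = H'" "H \<in> closed_subgroups G T"
        using A(2) k closed_subgroups_subset[of H'] conjugate_closed_subgroup[of "inv k" H']
        by (auto simp: conjugate_conjugate conjugate_one)
      with H' show "H \<in> conjugate G k -` A \<inter> space \<nu>"
        by (simp add: sets_\<nu>(2))
    qed
    then show "emeasure (distr \<nu> \<nu> (conjugate G k)) A = emeasure \<nu> A"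
      using A \<nu> k by (simp add: emeasure_distr[OF t] invariant_subgroup_measure_def)
  qed simp
  then show ?thesis
    using nn_integral_distr[OF t, of f] f by simp
qed

text \<open>Consider the map \<open>(H, g) \<mapsto> (H, \<rho> H g)\<close> with \<open>\<rho> H g = g \<otimes> k (inv g H g)\<close>. For
  almost every fixed \<open>H\<close> it preserves the Haar measure, since \<open>H\<close> is unimodular and \<open>\<rho> H\<close> is
  an \<open>H\<close>-equivariant map that preserves the cosets of \<open>H\<close>. In the coordinates \<open>(inv g H g, g)\<close>, in
  which the measure \<open>\<nu> \<Otimes> l\<close> looks the same by invariance of \<open>\<nu>\<close>, it is the right translation
  of the second coordinate by \<open>k H\<close>, which scales the Haar measure by \<open>\<mu> (k H)\<close>. Computing
  the integral of one function in both ways gives the claim.\<close>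

lemma nn_integral_modular_selection:
  assumes lc: "locally_compact_space T" and sc: "second_countable T"
    and l: "left_haar_measure G T l"
    and scale: "\<And>g S. g \<in> carrier G \<Longrightarrow> S \<in> sets l \<Longrightarrow>
      emeasure l S = ennreal (\<mu> g) * emeasure l (S #> g)"
    and \<nu>: "invariant_subgroup_measure G T \<nu>" and uni: "unimodular_subgroup_measure G T \<nu>"
    and k: "k \<in> measurable \<nu> (borel_algebra T)"
    and k_in: "\<And>H. H \<in> closed_subgroups G T \<Longrightarrow> k H \<in> H"
    and A: "A \<in> sets \<nu>"
  shows "(\<integral>\<^sup>+H. indicator A H * ennreal (\<mu> (k H)) \<partial>\<nu>) = emeasure \<nu> A"
proof -
  note sets_\<nu> = invariant_subgroup_measure_sets[OF \<nu>]
  note sets_l = left_haar_measure_sets[OF l]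
  interpret l: sigma_finite_measure l
    using haar_sigma_finite[OF l lc sc] .
  interpret \<nu>: sigma_finite_measure \<nu>
    using \<nu> by (simp add: invariant_subgroup_measure_def)
  interpret P: pair_sigma_finite \<nu> l ..
  have "\<one> \<in> topspace T"
    by (simp add: topspace_eq_carrier)
  then obtain W C where W: "openin T W" "compactin T C" "\<one> \<in> W" "W \<subseteq> C"
    using lc unfolding locally_compact_space_def by metis
  have W_sub: "W \<subseteq> carrier G"
    using openin_subset[OF W(1)] by (simp add: topspace_eq_carrier)
  have W_sets: "W \<in> sets l"
    using W(1) by (simp add: sets_l openin_imp_sets_borel_algebra)
  have W_positive: "emeasure l W \<noteq> 0"
    using haar_open_positive[OF l W(1,3)] .
  have "emeasure l W \<le> emeasure l C"
    using W(4) haar_compact_sets[OF l W(2)] by (rule emeasure_mono)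
  then have W_finite: "emeasure l W \<noteq> \<infinity>"
    using haar_compact_finite[OF l W(2)] by (auto simp: top_unique)

  define cj where "cj H g = conjugate G (inv g) H" for H g
  define \<rho> where "\<rho> H g = g \<otimes> k (cj H g)" for H g
  have cj_meas: "(\<lambda>p. cj (fst p) (snd p)) \<in> measurable (\<nu> \<Otimes>\<^sub>M l) \<nu>"
    using measurable_conjugate[OF lc sc]
    by (simp add: cj_def split_def measurable_cong_sets[OF sets_pair_measure_cong[OF sets_\<nu>(1) sets_l(1)] sets_\<nu>(1)])
  have k': "k \<in> measurable \<nu> l"
    using k by (simp add: measurable_cong_sets[OF refl sets_l(1)])
  have mult: "(\<lambda>p. fst p \<otimes> snd p) \<in> measurable (l \<Otimes>\<^sub>M l) l"
    using continuous_map_prod_measurable[OF sc sc continuous_mult]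
    by (simp add: split_def measurable_cong_sets[OF sets_pair_measure_cong[OF sets_l(1) sets_l(1)] sets_l(1)])
  have \<rho>_meas: "(\<lambda>p. \<rho> (fst p) (snd p)) \<in> measurable (\<nu> \<Otimes>\<^sub>M l) l"
    using measurable_compose[OF measurable_Pair[OF measurable_snd measurable_compose[OF cj_meas k']] mult]
    by (simp add: \<rho>_def)
  have cj_closed: "cj H g \<in> closed_subgroups G T"
    if "H \<in> closed_subgroups G T" "g \<in> carrier G" for H g
    using conjugate_closed_subgroup[OF inv_closed] that by (simp add: cj_def)
  have cj_mult: "cj H (h \<otimes> g) = cj H g"
    if H: "H \<in> closed_subgroups G T" and h: "h \<in> H" and g: "g \<in> carrier G" for H h g
  proof -
    have sub: "subgroup H G" "H \<subseteq> carrier G"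
      using H closed_subgroups_subset by (auto simp: closed_subgroups_def)
    then have "h \<in> carrier G"
      using h by auto
    then show ?thesis
      using conjugate_by_member[OF sub(1) subgroup.m_inv_closed[OF sub(1) h]]
        conjugate_conjugate[of "inv g" "inv h" H] g sub(2)
      by (simp add: cj_def inv_mult_group)
  qed
  have \<rho>_coset: "\<rho> H g \<in> H #> g" if H: "H \<in> closed_subgroups G T" and g: "g \<in> carrier G" for H g
  proof -
    have sub: "H \<subseteq> carrier G"
      using H by (rule closed_subgroups_subset)
    have "k (cj H g) \<in> cj H g"
      using k_in cj_closed[OF H g] .
    then have "k (cj H g) \<in> carrier G" "g \<otimes> k (cj H g) \<otimes> inv g \<in> H"
      using g sub by (auto simp: cj_def conjugate_eq_vimage)
    then show ?thesis
      using g sub by (simp add: \<rho>_def r_coset_eq_vimage)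
  qed
  have \<rho>_equiv: "\<rho> H (h \<otimes> g) = h \<otimes> \<rho> H g"
    if H: "H \<in> closed_subgroups G T" and h: "h \<in> H" and g: "g \<in> carrier G" for H h g
  proof -
    have "k (cj H g) \<in> cj H g"
      using k_in cj_closed[OF H g] .
    then have "k (cj H g) \<in> carrier G" "h \<in> carrier G"
      using closed_subgroups_subset[OF cj_closed[OF H g]] closed_subgroups_subset[OF H] h by auto
    then show ?thesis
      using g by (simp add: \<rho>_def cj_mult[OF H h g] m_assoc)
  qed
  have cj_\<rho>: "cj H (\<rho> H g) = cj H g" if H: "H \<in> closed_subgroups G T" and g: "g \<in> carrier G" for H g
    using \<rho>_coset[OF H g] cj_mult[OF H _ g] by (auto simp: r_coset_def)

  define F :: "'a set \<Rightarrow> 'a \<Rightarrow> ennreal" where "F H g = indicator A (cj H g) * indicator W g" for H g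
  have ind_A: "indicator A \<in> borel_measurable \<nu>" and ind_W: "indicator W \<in> borel_measurable l"
    using A W_sets by simp_all
  have F_meas: "(\<lambda>p. F (fst p) (snd p)) \<in> borel_measurable (\<nu> \<Otimes>\<^sub>M l)"
    unfolding F_def
    by (intro borel_measurable_times_ennreal measurable_compose[OF cj_meas ind_A]
        measurable_compose[OF measurable_snd ind_W])
  have "AE H in \<nu>. (\<integral>\<^sup>+g. F H (\<rho> H g) \<partial>l) = (\<integral>\<^sup>+g. F H g \<partial>l)"
    using uni unfolding unimodular_subgroup_measure_def
  proof (rule AE_mp, intro AE_I2 impI)
    fix H assume "H \<in> space \<nu>" and uni_H: "unimodular (G\<lparr>carrier := H\<rparr>) (subtopology T H)"
    then have H: "H \<in> closed_subgroups G T" "subgroup H G" "closedin T H" "H \<in> space \<nu>"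
      by (simp_all add: sets_\<nu>(2) closed_subgroups_def)
    have meas: "\<rho> H \<in> measurable l l" "F H \<in> borel_measurable l"
      using measurable_compose[OF measurable_Pair1'[OF H(4)] \<rho>_meas]
        measurable_compose[OF measurable_Pair1'[OF H(4)] F_meas] by simp_all
    show "(\<integral>\<^sup>+g. F H (\<rho> H g) \<partial>l) = (\<integral>\<^sup>+g. F H g \<partial>l)"
      by (rule nn_integral_orbit_map[OF lc sc l H(2,3) uni_H meas(1) \<rho>_equiv[OF H(1)]
            \<rho>_coset[OF H(1)] W(1,4,2) meas(2)]) (simp_all add: F_def)
  qed
  then have eq: "(\<integral>\<^sup>+H. (\<integral>\<^sup>+g. F H (\<rho> H g) \<partial>l) \<partial>\<nu>) = (\<integral>\<^sup>+H. (\<integral>\<^sup>+g. F H g \<partial>l) \<partial>\<nu>)"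
    by (rule nn_integral_cong_AE)

  have "(\<integral>\<^sup>+H. (\<integral>\<^sup>+g. F H g \<partial>l) \<partial>\<nu>) = (\<integral>\<^sup>+g. (\<integral>\<^sup>+H. F H g \<partial>\<nu>) \<partial>l)"
    using P.Fubini'[of F] F_meas by (simp add: split_def)
  also have "\<dots> = (\<integral>\<^sup>+g. emeasure \<nu> A * indicator W g \<partial>l)"
  proof (rule nn_integral_cong)
    fix g assume "g \<in> space l"
    then have g: "g \<in> carrier G"
      by (simp add: sets_l(2))
    have "(\<lambda>H. indicator A H * indicator W g :: ennreal) \<in> borel_measurable \<nu>"
      using ind_A by (intro borel_measurable_times_ennreal) simp_all
    from nn_integral_conjugate[OF lc sc \<nu> inv_closed[OF g] this]
    have "(\<integral>\<^sup>+H. F H g \<partial>\<nu>) = (\<integral>\<^sup>+H. indicator A H * indicator W g \<partial>\<nu>)"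
      by (simp add: F_def cj_def)
    also have "\<dots> = emeasure \<nu> A * indicator W g"
      using nn_integral_multc[OF ind_A, of "indicator W g"] A by simp
    finally show "(\<integral>\<^sup>+H. F H g \<partial>\<nu>) = emeasure \<nu> A * indicator W g" .
  qed
  also have "\<dots> = emeasure \<nu> A * emeasure l W"
    using nn_integral_cmult_indicator[OF W_sets] .
  finally have direct: "(\<integral>\<^sup>+H. (\<integral>\<^sup>+g. F H g \<partial>l) \<partial>\<nu>) = emeasure \<nu> A * emeasure l W" .

  define F' :: "'a set \<Rightarrow> 'a \<Rightarrow> ennreal" where
    "F' H g = indicator A H * indicator W (g \<otimes> k H)" for H g
  have F'_meas: "(\<lambda>p. F' (fst p) (snd p)) \<in> borel_measurable (\<nu> \<Otimes>\<^sub>M l)"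
  proof -
    have "(\<lambda>p. snd p \<otimes> k (fst p)) \<in> measurable (\<nu> \<Otimes>\<^sub>M l) l"
      using measurable_compose[OF measurable_Pair[OF measurable_snd measurable_compose[OF measurable_fst k']] mult]
      by simp
    then show ?thesis
      unfolding F'_def
      by (intro borel_measurable_times_ennreal measurable_compose[OF measurable_fst ind_A]
          measurable_compose[OF _ ind_W])
  qed
  have "(\<integral>\<^sup>+H. (\<integral>\<^sup>+g. F H (\<rho> H g) \<partial>l) \<partial>\<nu>) = (\<integral>\<^sup>+g. (\<integral>\<^sup>+H. F H (\<rho> H g) \<partial>\<nu>) \<partial>l)"
    using P.Fubini'[of "\<lambda>H g. F H (\<rho> H g)"]
      measurable_compose[OF measurable_Pair[OF measurable_fst \<rho>_meas] F_meas]
    by (simp add: split_def)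
  also have "\<dots> = (\<integral>\<^sup>+g. (\<integral>\<^sup>+H. F' H g \<partial>\<nu>) \<partial>l)"
  proof (rule nn_integral_cong)
    fix g assume "g \<in> space l"
    then have g: "g \<in> carrier G" "g \<in> space l"
      by (simp_all add: sets_l(2))
    have "(\<integral>\<^sup>+H. F H (\<rho> H g) \<partial>\<nu>) = (\<integral>\<^sup>+H. F' (conjugate G (inv g) H) g \<partial>\<nu>)"
    proof (rule nn_integral_cong)
      fix H assume "H \<in> space \<nu>"
      then show "F H (\<rho> H g) = F' (conjugate G (inv g) H) g"
        using cj_\<rho>[OF _ g(1), of H] by (simp add: F_def F'_def sets_\<nu>(2)) (simp add: \<rho>_def cj_def)
    qed
    also have "\<dots> = (\<integral>\<^sup>+H. F' H g \<partial>\<nu>)"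
      using measurable_compose[OF measurable_Pair2'[OF g(2)] F'_meas]
      by (intro nn_integral_conjugate[OF lc sc \<nu> inv_closed[OF g(1)]]) simp
    finally show "(\<integral>\<^sup>+H. F H (\<rho> H g) \<partial>\<nu>) = (\<integral>\<^sup>+H. F' H g \<partial>\<nu>)" .
  qed
  also have "\<dots> = (\<integral>\<^sup>+H. (\<integral>\<^sup>+g. F' H g \<partial>l) \<partial>\<nu>)"
    using P.Fubini'[of F'] F'_meas by (simp add: split_def)
  finally have twisted: "(\<integral>\<^sup>+H. (\<integral>\<^sup>+g. F H (\<rho> H g) \<partial>l) \<partial>\<nu>) =
    (\<integral>\<^sup>+H. (\<integral>\<^sup>+g. F' H g \<partial>l) \<partial>\<nu>)" .
  have F'_integral: "(\<integral>\<^sup>+g. F' H g \<partial>l) = indicator A H * ennreal (\<mu> (k H)) * emeasure l W"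
    if H: "H \<in> closed_subgroups G T" for H
  proof -
    have kH: "k H \<in> carrier G"
      using k_in[OF H] closed_subgroups_subset[OF H] by auto
    define S where "S = W #> inv (k H)"
    have S_eq: "S = {g \<in> carrier G. g \<otimes> k H \<in> W}"
      using kH W_sub by (simp add: S_def r_coset_eq_vimage)
    have "continuous_map T T (\<lambda>g. g \<otimes> k H)"
      by (intro continuous_map_group_mult continuous_map_group_const kH
          continuous_map_id[unfolded id_def])
    from openin_continuous_map_preimage[OF this W(1)]
    have S_sets: "S \<in> sets l"
      by (simp add: S_eq sets_l(1) openin_imp_sets_borel_algebra topspace_eq_carrier)
    have "S #> k H = W"
      unfolding S_def using W_sub kH by (simp add: coset_mult_assoc)
    then have l_S: "emeasure l S = ennreal (\<mu> (k H)) * emeasure l W"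
      using scale[OF kH S_sets] by simp
    have "(\<integral>\<^sup>+g. F' H g \<partial>l) = (\<integral>\<^sup>+g. indicator A H * indicator S g \<partial>l)"
      by (intro nn_integral_cong) (simp add: F'_def S_eq sets_l(2) indicator_def)
    also have "\<dots> = indicator A H * emeasure l S"
      using nn_integral_cmult_indicator[OF S_sets] .
    finally show "(\<integral>\<^sup>+g. F' H g \<partial>l) = indicator A H * ennreal (\<mu> (k H)) * emeasure l W"
      by (simp add: l_S mult.assoc)
  qed
  \<comment> \<open>The modular function along the selection is measurable because it is, up to the constant
    \<open>l W\<close>, the inner integral here.\<close>
  have meas: "(\<lambda>H. \<integral>\<^sup>+g. F' H g \<partial>l) \<in> borel_measurable \<nu>"
    using l.borel_measurable_nn_integral[of F' \<nu>] F'_meas by (simp add: split_def)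
  have "(\<integral>\<^sup>+H. indicator A H * ennreal (\<mu> (k H)) \<partial>\<nu>) =
      (\<integral>\<^sup>+H. (\<integral>\<^sup>+g. F' H g \<partial>l) / emeasure l W \<partial>\<nu>)"
    using F'_integral W_positive W_finite
    by (intro nn_integral_cong) (simp add: sets_\<nu>(2) mult_divide_eq_ennreal)
  also have "\<dots> = (\<integral>\<^sup>+H. (\<integral>\<^sup>+g. F' H g \<partial>l) \<partial>\<nu>) / emeasure l W"
    using nn_integral_divide[OF meas] .
  also have "\<dots> = emeasure \<nu> A * emeasure l W / emeasure l W"
    using eq direct twisted by simp
  also have "\<dots> = emeasure \<nu> A"
    using W_positive W_finite by (simp add: mult_divide_eq_ennreal)
  finally show ?thesis .
qed

end

theorem corollary1p2:
  fixes G :: "('a, 'b) monoid_scheme" and T :: "'a topology"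
    and \<mu> :: "'a \<Rightarrow> real" and \<nu> :: "'a set measure"
  assumes "topological_group G T"
    and "locally_compact_space T"
    and "second_countable T"
    and "is_modular_function G T \<mu>"
    and "invariant_subgroup_measure G T \<nu>"
    and "unimodular_subgroup_measure G T \<nu>"
  shows "\<forall>H \<in> topological_support (chabauty_topology G T) \<nu>. H \<subseteq> kernel G pos_real_group \<mu>"
proof (rule ballI, rule ccontr)
  interpret topological_group G T
    by fact
  note lc = assms(2) and sc = assms(3) and \<nu> = assms(5)
  note sets_\<nu> = invariant_subgroup_measure_sets[OF \<nu>]
  interpret \<nu>: sigma_finite_measure \<nu>
    using \<nu> by (simp add: invariant_subgroup_measure_def)
  have \<mu>_hom: "\<mu> \<in> hom G pos_real_group"
    using assms(4) by (simp add: is_modular_function_def)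
  obtain l where l: "left_haar_measure G T l"
    and scale: "\<And>g S. g \<in> carrier G \<Longrightarrow> S \<in> sets l \<Longrightarrow>
      emeasure l S = ennreal (\<mu> g) * emeasure l (S #>\<^bsub>G\<^esub> g)"
    using assms(4) by (auto simp: is_modular_function_def)
  have \<mu>_pos: "\<mu> g > 0" if "g \<in> carrier G" for g
    using hom_in_carrier[OF \<mu>_hom that] by (simp add: pos_real_group_def)
  have \<mu>_mult: "\<mu> (g \<otimes>\<^bsub>G\<^esub> g') = \<mu> g * \<mu> g'" if "g \<in> carrier G" "g' \<in> carrier G" for g g'
    using hom_mult[OF \<mu>_hom that] by (simp add: pos_real_group_def)
  have \<mu>_one: "\<mu> \<one>\<^bsub>G\<^esub> = 1"
    using \<mu>_mult[of "\<one>\<^bsub>G\<^esub>" "\<one>\<^bsub>G\<^esub>"] \<mu>_pos[of "\<one>\<^bsub>G\<^esub>"] by simp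

  fix H\<^sub>0 assume supp: "H\<^sub>0 \<in> topological_support (chabauty_topology G T) \<nu>"
    and not_sub: "\<not> H\<^sub>0 \<subseteq> kernel G pos_real_group \<mu>"
  have H0: "H\<^sub>0 \<in> closed_subgroups G T" "subgroup H\<^sub>0 G" "H\<^sub>0 \<subseteq> carrier G"
    using supp closed_subgroups_subset
    by (auto simp: topological_support_def topspace_chabauty_topology closed_subgroups_def)
  obtain x where x: "x \<in> H\<^sub>0" "x \<in> carrier G" "\<mu> x \<noteq> 1"
    using not_sub H0(3) by (auto simp: kernel_def pos_real_group_def)
  obtain h where h: "h \<in> H\<^sub>0" "h \<in> carrier G" "\<mu> h > 1"
  proof (cases "\<mu> x > 1")
    case True
    then show ?thesis
      using that[OF x(1,2)] by simp
  next
    case False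
    have "\<mu> x * \<mu> (inv\<^bsub>G\<^esub> x) = 1"
      using \<mu>_mult[OF x(2) inv_closed[OF x(2)]] x(2) \<mu>_one by simp
    then have "\<mu> (inv\<^bsub>G\<^esub> x) = 1 / \<mu> x"
      using \<mu>_pos[OF x(2)] by (simp add: field_simps)
    then have "\<mu> (inv\<^bsub>G\<^esub> x) > 1"
      using False x(3) \<mu>_pos[OF x(2)] by simp
    then show ?thesis
      using that[OF subgroup.m_inv_closed[OF H0(2) x(1)] inv_closed[OF x(2)]] by simp
  qed
  \<comment> \<open>A uniform lower bound above 1 keeps the inequality strict after integration.\<close>
  obtain c where c: "1 < c" "c < \<mu> h"
    using dense[OF h(3)] by auto
  have large: "openin T {g \<in> carrier G. c < \<mu> g}"
  proof (rule openin_modular_superlevel[OF l])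
    show "0 < c"
      using c(1) by simp
  qed (fact scale, fact \<mu>_pos)
  have base: "neighbourhood_base_of (compactin T) T"
    using locally_compact_space_neighbourhood_base[of T] Hausdorff lc by simp
  have "h \<in> {g \<in> carrier G. c < \<mu> g}"
    using h c by simp
  with base[unfolded neighbourhood_base_of] large
  obtain U C where U: "openin T U" "compactin T C" "h \<in> U" "U \<subseteq> C"
    "C \<subseteq> {g \<in> carrier G. c < \<mu> g}"
    by (elim allE[of _ "{g \<in> carrier G. c < \<mu> g}"] allE[of _ h] impE exE conjE) simp_all

  define O' where "O' = {H \<in> closed_subgroups G T. H \<inter> U \<noteq> {}}"
  have O_open: "openin (chabauty_topology G T) O'"
    unfolding O'_def using openin_chabauty_meeting[OF U(1)] .
  have O_sets: "O' \<in> sets \<nu>"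
    using O_open by (simp add: sets_\<nu>(1) openin_imp_sets_borel_algebra)
  have "H\<^sub>0 \<in> O'"
    using H0(1) h(1) U(3) by (auto simp: O'_def)
  then have O_pos: "emeasure \<nu> O' > 0"
    using supp O_open by (simp add: topological_support_def)
  obtain A where A: "A \<in> sets \<nu>" "A \<subseteq> O'" "emeasure \<nu> A > 0" "emeasure \<nu> A < \<infinity>"
  proof (cases "emeasure \<nu> O' = \<infinity>")
    case True
    from \<nu>.approx_PInf_emeasure_with_finite[OF O_sets this, of 0] show ?thesis
      using that by auto
  next
    case False
    then show ?thesis
      using that[OF O_sets subset_refl O_pos] by (simp add: less_top)
  qed

  \<comment> \<open>Select from \<open>H \<inter> C\<close> where possible; elsewhere the unit is a point of every subgroup.\<close>
  define \<Phi> where "\<Phi> H = (if H \<inter> C = {} then {\<one>\<^bsub>G\<^esub>} else H \<inter> C)" for H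
  obtain k where k: "k \<in> measurable \<nu> (borel_algebra T)" "\<And>H. H \<in> space \<nu> \<Longrightarrow> k H \<in> \<Phi> H"
  proof (rule measurable_selection_compact[OF Hausdorff sc])
    fix H assume "H \<in> space \<nu>"
    then have "closedin T H"
      by (simp add: sets_\<nu>(2) closed_subgroups_def)
    then have "compactin T (H \<inter> C)"
      using U(2) by (rule closed_Int_compactin)
    then show "compactin T (\<Phi> H) \<and> \<Phi> H \<noteq> {}"
      by (simp add: \<Phi>_def topspace_eq_carrier)
  next
    fix F assume F: "closedin T F"
    have avoid: "avoiding K \<in> sets \<nu>" if "compactin T K" for K
      using openin_chabauty_avoiding[OF that]
      by (simp add: sets_\<nu>(1) openin_imp_sets_borel_algebra)
    have "compactin T (C \<inter> F)"
      using U(2) F by (rule compact_Int_closedin)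
    then have "(space \<nu> - avoiding (C \<inter> F)) \<union> (if \<one>\<^bsub>G\<^esub> \<in> F then avoiding C else {}) \<in> sets \<nu>"
      using avoid U(2) by (simp add: sets.Un sets.compl_sets)
    moreover have "{H \<in> space \<nu>. \<Phi> H \<inter> F \<noteq> {}} =
        (space \<nu> - avoiding (C \<inter> F)) \<union> (if \<one>\<^bsub>G\<^esub> \<in> F then avoiding C else {})"
      by (auto simp: \<Phi>_def sets_\<nu>(2) split: if_splits)
    ultimately show "{H \<in> space \<nu>. \<Phi> H \<inter> F \<noteq> {}} \<in> sets \<nu>"
      by simp
  qed (rule that)
  have k_in: "k H \<in> H" if "H \<in> closed_subgroups G T" for H
    using k(2)[of H] that subgroup.one_closed[of H G]
    by (auto simp: \<Phi>_def sets_\<nu>(2) closed_subgroups_def split: if_splits)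
  have k_large: "c \<le> \<mu> (k H)" if "H \<in> A" for H
  proof -
    have "H \<in> closed_subgroups G T" "H \<inter> C \<noteq> {}"
      using that A(2) U(4) by (auto simp: O'_def)
    then have "k H \<in> C"
      using k(2)[of H] by (simp add: \<Phi>_def sets_\<nu>(2))
    then show ?thesis
      using U(5) by auto
  qed

  have "ennreal c * emeasure \<nu> A = (\<integral>\<^sup>+H. ennreal c * indicator A H \<partial>\<nu>)"
    using nn_integral_cmult_indicator[OF A(1)] by simp
  also have "\<dots> \<le> (\<integral>\<^sup>+H. indicator A H * ennreal (\<mu> (k H)) \<partial>\<nu>)"
    using k_large by (intro nn_integral_mono) (auto simp: indicator_def intro: ennreal_leI)
  also have "\<dots> = emeasure \<nu> A"
    by (rule nn_integral_modular_selection[OF lc sc l _ \<nu> assms(6) k(1) _ A(1)])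
      (fact scale, fact k_in)
  finally have le: "ennreal c * emeasure \<nu> A \<le> emeasure \<nu> A" .
  define a where "a = measure \<nu> A"
  have a: "emeasure \<nu> A = ennreal a"
    using A(4) by (simp add: a_def emeasure_eq_ennreal_measure less_top)
  then have "a > 0"
    using A(3) by simp
  have "c * a \<le> a"
    using le \<open>a > 0\<close> c(1) by (simp add: a ennreal_mult[symmetric])
  then show False
    using \<open>a > 0\<close> c(1) by simp
qed

end
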